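(* Let $b\ge3$ be an integer and let $D\subset\{0,1,\dots,b-1\}$ with $2\le\#D<b$. Suppose that $b$ is a prime number and that $K_{b,D}$ is symmetric, i.e. $K_{b,D}=c-K_{b,D}$ for some $c\in\mathbb{R}$. Let $\gamma\in\mathbb{R}$. Then $$\overline{\dim}_{\rm M}\big((\gamma K_{b,D}+\alpha)\cap K_{b,D}\big)<\dim_{\rm H}K_{b,D}\quad\text{for every }\alpha\in\mathbb{R}$$ if and only if $\gamma\notin\{\pm b^k:k\in\mathbb{Z}\}$.
   Context: The missing-digit set with base $b$ and digit set $D$ is $K_{b,D}=\left\{\sum_{j=1}^\infty \varepsilon_j b^{-j}:\varepsilon_j\in D\text{ for all }j\ge1\right\}$. $\gamma K+\alpha=\{\gamma x+\alpha:x\in K\}$ and $c-K=\{c-x:x\in K\}$. $\dim_{\rm H}$ denotes Hausdorff dimension. For a non-empty bounded $A\subset\mathbb{R}$, the upper Minkowski dimension is $\overline{\dim}_{\rm M}A=\limsup_{\delta\to0}\frac{\log N_\delta(A)}{-\log\delta}$, where $N_\delta(A)$ is the smallest number of closed intervals of length $\delta$ needed to cover $A$. Convention: $\overline{\dim}_{\rm M}\emptyset=\dim_{\rm H}\emptyset=0$. *)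

theory Defs
  imports "HOL-Analysis.Analysis" "HOL-Computational_Algebra.Primes"
begin

definition missing_digit_set :: "nat \<Rightarrow> nat set \<Rightarrow> real set" where
  "missing_digit_set b D =
     {\<Sum>j. real (\<epsilon> (Suc j)) / real b ^ Suc j | \<epsilon> :: nat \<Rightarrow> nat. \<forall>j\<ge>1. \<epsilon> j \<in> D}"

text \<open>The term \<open>diam(U)\<^sup>s\<close> in the Hausdorff sums, with the usual conventions that the empty set
  contributes 0 and that \<open>0\<^sup>0 = 1\<close> for nonempty sets (whereas \<open>0 powr 0 = 0\<close>),
  so that the 0-dimensional measure is counting measure.\<close>

definition diam_power :: "real \<Rightarrow> 'a::metric_space set \<Rightarrow> real" where
  "diam_power s U = (if U = {} then 0 else if s = 0 then 1 else diameter U powr s)"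

text \<open>Boundedness is required of the covering sets because \<open>diameter\<close> is
  unspecified on unbounded sets.\<close>

definition hausdorff_premeasure :: "real \<Rightarrow> real \<Rightarrow> 'a::metric_space set \<Rightarrow> ennreal" where
  "hausdorff_premeasure s \<delta> A =
     (INF U \<in> {U :: nat \<Rightarrow> 'a set. A \<subseteq> (\<Union>i. U i) \<and> (\<forall>i. bounded (U i) \<and> diameter (U i) \<le> \<delta>)}.
        \<Sum>i. ennreal (diam_power s (U i)))"

definition hausdorff_measure :: "real \<Rightarrow> 'a::metric_space set \<Rightarrow> ennreal" where
  "hausdorff_measure s A = (SUP \<delta> \<in> {0<..}. hausdorff_premeasure s \<delta> A)"

definition hausdorff_dim :: "'a::metric_space set \<Rightarrow> ereal" where
  "hausdorff_dim A = (INF s \<in> {s. 0 \<le> s \<and> hausdorff_measure s A = 0}. ereal s)"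

text \<open>Intervals are given by their left endpoints. Meaningful for bounded \<open>A\<close> and \<open>\<delta> > 0\<close>.\<close>

definition covering_number :: "real \<Rightarrow> real set \<Rightarrow> nat" where
  "covering_number \<delta> A =
     (LEAST n. \<exists>C. finite C \<and> card C = n \<and> A \<subseteq> (\<Union>x\<in>C. {x..x + \<delta>}))"

definition upper_minkowski_dim :: "real set \<Rightarrow> ereal" where
  "upper_minkowski_dim A =
     (if A = {} then 0
      else Limsup (at_right 0) (\<lambda>\<delta>. ereal (ln (real (covering_number \<delta> A)) / (- ln \<delta>))))"

end

theory Submission
  imports Defs
begin

text \<open>
  Write \<open>K\<close> for the missing digit set and \<open>s = log #D / log b\<close> for its dimension. If
  \<open>(\<gamma> K + \<alpha>) \<inter> K\<close> does not have upper Minkowski dimension below \<open>s\<close>, then for every \<open>m\<close> it meets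
  all descendants \<open>m\<close> generations below some cylinder of \<open>K\<close>; otherwise the number of cylinders
  met would lose a fixed factor against the maximum every \<open>m\<close> generations. On zooming in, only boundedly
  many translates of \<open>\<gamma> K\<close> remain visible, so that in the limit they cover \<open>K\<close>, and by Baire's
  argument a single copy \<open>\<gamma> b\<^sup>l K + t\<close> contains \<open>K\<close>. Its inverse maps \<open>K\<close> into \<open>K\<close>; applying
  the same zoom to the image yields \<open>\<nu>\<close>, equal to \<open>1 / \<gamma>\<close> up to a power of \<open>b\<close>, for which \<open>K\<close> and
  \<open>\<nu> K + t\<close> coincide inside \<open>(0, 1)\<close>. Small gaps of \<open>\<nu> K + t\<close> are therefore gaps of \<open>K\<close>.
  Up to powers of \<open>b\<close> there are only finitely many gap lengths, all rational, so \<open>|\<nu>|\<close> is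
  rational and some power of it is a power of \<open>b\<close>. As \<open>b\<close> is prime, \<open>|\<nu>|\<close> is itself a power of \<open>b\<close>.
\<close>

subsection \<open>Cylinders\<close>

locale missing_digits =
  fixes b :: nat and D :: "nat set"
  assumes D_subset: "D \<subseteq> {..<b}" and card_D: "2 \<le> card D"
begin

abbreviation K :: "real set" where "K \<equiv> missing_digit_set b D"
abbreviation B :: real where "B \<equiv> real b"

text \<open>Integers written with \<open>n\<close> base-\<open>b\<close> digits from
  \<open>D\<close>, leading zeros included; they index the level-\<open>n\<close> cylinders. The
  type is \<open>int\<close> because zooming subtracts them.\<close>

primrec prefixes :: "nat \<Rightarrow> int set" where
  "prefixes 0 = {0}"
| "prefixes (Suc n) = (\<lambda>(p, d). int b * p + int d) ` (prefixes n \<times> D)"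

lemma finite_D: "finite D"
  using D_subset finite_subset by blast

lemma D_less: "d \<in> D \<Longrightarrow> d < b"
  using D_subset by auto

lemma b_ge_2: "2 \<le> b"
  using card_mono[OF _ D_subset] card_D by simp

lemma B_gt_1: "1 < B" and B_pos: "0 < B"
  using b_ge_2 by auto

lemma tendsto_inverse_B_power: "(\<lambda>n. c / B ^ n) \<longlonglongrightarrow> 0"
  using LIMSEQ_divide_realpow_zero[OF B_gt_1, of c] by simp

lemma B_power_unbounded: "\<exists>n. x < B ^ n"
  using real_arch_pow[OF B_gt_1] by blast

text \<open>Splitting off digits forever writes \<open>x\<close> as a digit series, and boundedness
  of \<open>S\<close> sends the remainder to 0. Later membership proofs then only have to name a
  suitable \<open>S\<close>.\<close>

lemma K_coinduct:
  assumes bnd: "\<And>x. x \<in> S \<Longrightarrow> \<bar>x\<bar> \<le> R"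
    and step: "\<And>x. x \<in> S \<Longrightarrow> \<exists>d\<in>D. B * x - real d \<in> S"
    and "x \<in> S"
  shows "x \<in> K"
proof -
  obtain dig where dig: "\<And>x. x \<in> S \<Longrightarrow> dig x \<in> D \<and> B * x - real (dig x) \<in> S"
    using step by metis
  define y where "y = rec_nat x (\<lambda>_ z. B * z - real (dig z))"
  have y0: "y 0 = x" and yS: "\<And>n. y (Suc n) = B * y n - real (dig (y n))"
    by (simp_all add: y_def)
  have yin: "y n \<in> S" for n
    by (induction n) (use \<open>x \<in> S\<close> dig y0 yS in auto)
  have part: "(\<Sum>j<n. real (dig (y j)) / B ^ Suc j) = x - y n / B ^ n" for n
  proof (induction n)
    case (Suc n)
    have "y n / B ^ n = B * y n / B ^ Suc n" using B_pos by simp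
    then show ?case using Suc by (simp add: yS diff_divide_distrib)
  qed (simp add: y0)
  have "(\<lambda>n. y n / B ^ n) \<longlonglongrightarrow> 0"
  proof (rule Lim_null_comparison)
    show "\<forall>\<^sub>F n in sequentially. norm (y n / B ^ n) \<le> R / B ^ n"
      using bnd[OF yin] B_pos by (auto intro!: always_eventually divide_right_mono)
  qed (rule tendsto_inverse_B_power)
  then have "(\<lambda>n. x - y n / B ^ n) \<longlonglongrightarrow> x"
    using tendsto_diff[OF tendsto_const[of x]] by fastforce
  then have "(\<lambda>j. real (dig (y j)) / B ^ Suc j) sums x"
    unfolding sums_def part .
  then have "x = (\<Sum>j. real (dig (y j)) / B ^ Suc j)"
    by (simp add: sums_iff)
  moreover have "\<forall>j\<ge>1. dig (y (j - 1)) \<in> D"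
    using dig yin by blast
  ultimately show ?thesis
    unfolding missing_digit_set_def
    by (intro CollectI exI[of _ "\<lambda>j. dig (y (j - 1))"]) simp
qed

lemma
  assumes eps: "\<forall>j\<ge>1. \<epsilon> j \<in> D"
  shows digits_summable: "summable (\<lambda>j. real (\<epsilon> (Suc j)) / B ^ Suc j)" (is ?A)
    and digits_suminf_bounds: "(\<Sum>j. real (\<epsilon> (Suc j)) / B ^ Suc j) \<in> {0..1}" (is ?B)
proof -
  \<comment> \<open>The series with all digits equal to \<open>b - 1\<close> dominates every digit
    series and sums to 1.\<close>
  have geo: "(\<lambda>j. (B - 1) / B ^ Suc j) sums 1"
  proof -
    have "(\<lambda>j. (B - 1) / B * (1 / B) ^ j) sums ((B - 1) / B * (1 / (1 - 1 / B)))"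
      using B_gt_1 by (intro sums_mult geometric_sums) auto
    moreover have "(B - 1) / B * (1 / (1 - 1 / B)) = 1"
    proof -
      have "(B - 1) / B = 1 - 1 / B" "1 - 1 / B \<noteq> 0" using B_gt_1 by (simp_all add: diff_divide_distrib)
      then show ?thesis by simp
    qed
    moreover have "(\<lambda>j. (B - 1) / B * (1 / B) ^ j) = (\<lambda>j. (B - 1) / B ^ Suc j)"
      by (simp add: power_one_over)
    ultimately show ?thesis by metis
  qed
  have le: "real (\<epsilon> (Suc j)) / B ^ Suc j \<le> (B - 1) / B ^ Suc j" for j
  proof -
    have "\<epsilon> (Suc j) < b" using eps D_less by auto
    then have "real (\<epsilon> (Suc j)) \<le> B - 1" by linarith
    then show ?thesis using B_pos by (intro divide_right_mono) auto
  qed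
  show ?A
    by (rule summable_comparison_test'[OF sums_summable[OF geo], of 0]) (use le in auto)
  then have "(\<Sum>j. real (\<epsilon> (Suc j)) / B ^ Suc j) \<le> 1"
    using suminf_le[OF le _ sums_summable[OF geo]] geo by (simp add: sums_iff)
  moreover have "0 \<le> (\<Sum>j. real (\<epsilon> (Suc j)) / B ^ Suc j)"
    using \<open>?A\<close> by (intro suminf_nonneg) auto
  ultimately show ?B by simp
qed

lemma K_bounds: "x \<in> K \<Longrightarrow> 0 \<le> x \<and> x \<le> 1"
proof -
  assume "x \<in> K"
  then obtain \<epsilon> where "\<forall>j\<ge>1. \<epsilon> j \<in> D" "x = (\<Sum>j. real (\<epsilon> (Suc j)) / B ^ Suc j)"
    unfolding missing_digit_set_def by blast
  then show "0 \<le> x \<and> x \<le> 1" using digits_suminf_bounds[of \<epsilon>] by simp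
qed

lemma K_first_digit:
  assumes "x \<in> K"
  obtains d where "d \<in> D" "B * x - real d \<in> K"
proof -
  obtain \<epsilon> where eps: "\<forall>j\<ge>1. \<epsilon> j \<in> D" and x: "x = (\<Sum>j. real (\<epsilon> (Suc j)) / B ^ Suc j)"
    using assms unfolding missing_digit_set_def by blast
  have sh: "\<forall>j\<ge>1. \<epsilon> (Suc j) \<in> D" using eps by auto
  have "x = real (\<epsilon> 1) / B + (\<Sum>j. real (\<epsilon> (Suc (Suc j))) / B ^ Suc (Suc j))"
    unfolding x using suminf_split_head[OF digits_summable[OF eps]] by simp
  also have "(\<Sum>j. real (\<epsilon> (Suc (Suc j))) / B ^ Suc (Suc j))
      = (\<Sum>j. real (\<epsilon> (Suc (Suc j))) / B ^ Suc j) / B"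
    using suminf_divide[OF digits_summable[OF sh], of B] by (simp add: field_simps)
  finally have "B * x - real (\<epsilon> 1) = (\<Sum>j. real (\<epsilon> (Suc (Suc j))) / B ^ Suc j)"
    using B_pos by (simp add: field_simps)
  also have "\<dots> \<in> K"
    unfolding missing_digit_set_def using sh
    by (intro CollectI exI[of _ "\<lambda>j. \<epsilon> (Suc j)"]) simp
  finally show thesis using that[of "\<epsilon> 1"] eps by simp
qed

lemma K_prepend_digit:
  assumes "x \<in> K" "d \<in> D"
  shows "(x + real d) / B \<in> K"
\<comment> \<open>Coinduction on \<open>K\<close> with the new point added: splitting
  \<open>d\<close> off that point leads back into \<open>K\<close>.\<close>
proof (rule K_coinduct[of "insert ((x + real d) / B) K" "1 + B"])
  show "\<bar>z\<bar> \<le> 1 + B" if "z \<in> insert ((x + real d) / B) K" for z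
  proof -
    have "0 \<le> z \<and> z \<le> 1"
    proof (cases "z \<in> K")
      case False
      with that have z: "z = (x + real d) / B" by simp
      have "real d + 1 \<le> B" using D_less[OF \<open>d \<in> D\<close>] by linarith
      then show ?thesis using K_bounds[OF \<open>x \<in> K\<close>] B_pos by (simp add: z)
    qed (rule K_bounds)
    then show ?thesis using B_pos by linarith
  qed
  show "\<exists>d'\<in>D. B * z - real d' \<in> insert ((x + real d) / B) K"
    if "z \<in> insert ((x + real d) / B) K" for z
  proof (cases "z \<in> K")
    case True
    then show ?thesis using K_first_digit by (metis insertI2)
  next
    case False
    with that assms B_pos show ?thesis by (intro bexI[of _ d]) auto
  qed
qed simp

text \<open>The closure inherits the splitting of digits, because the finite union of the preimages
  of \<open>closure K\<close> under the maps \<open>B * x - d\<close> is closed and contains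
  \<open>K\<close>. Coinduction then places the closure inside \<open>K\<close>.\<close>

lemma K_closed: "closed K"
proof -
  have "closure K \<subseteq> K"
  proof
    fix x assume "x \<in> closure K"
    show "x \<in> K"
    proof (rule K_coinduct[of "closure K" 1, OF _ _ \<open>x \<in> closure K\<close>])
      have "closure K \<subseteq> {0..1}"
        by (rule closure_minimal) (use K_bounds in auto)
      then show "\<bar>z\<bar> \<le> 1" if "z \<in> closure K" for z using that by fastforce
      fix z assume z: "z \<in> closure K"
      have "closed (\<Union>d\<in>D. (\<lambda>x. B * x - real d) -` closure K)"
        using finite_D by (intro closed_UN ballI closed_vimage continuous_intros) auto
      moreover have "K \<subseteq> (\<Union>d\<in>D. (\<lambda>x. B * x - real d) -` closure K)"
      proof
        fix y assume "y \<in> K"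
        then show "y \<in> (\<Union>d\<in>D. (\<lambda>x. B * x - real d) -` closure K)"
          by (rule K_first_digit) (use closure_subset in fastforce)
      qed
      ultimately have "closure K \<subseteq> (\<Union>d\<in>D. (\<lambda>x. B * x - real d) -` closure K)"
        by (rule closure_minimal[rotated])
      then show "\<exists>d\<in>D. B * z - real d \<in> closure K" using z by blast
    qed
  qed
  then show ?thesis using closure_subset_eq by blast
qed

lemma K_compact: "compact K"
proof (rule compact_eq_bounded_closed[THEN iffD2], intro conjI K_closed)
  show "bounded K" by (rule bounded_subset[of "{0..1}"]) (use K_bounds in auto)
qed

lemma K_nonempty: "K \<noteq> {}"
proof -
  obtain d where "d \<in> D" using card_D by fastforce
  then have "(\<Sum>j. real d / B ^ Suc j) \<in> K"
    unfolding missing_digit_set_def by (intro CollectI exI[of _ "\<lambda>_. d"]) simp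
  then show ?thesis by blast
qed

section \<open>Prefixes, cylinders and covers by intervals\<close>

lemma finite_prefixes: "finite (prefixes n)"
  by (induction n) (use finite_D in auto)

lemma prefixes_bounds: "p \<in> prefixes n \<Longrightarrow> 0 \<le> p \<and> p < int b ^ n"
proof (induction n arbitrary: p)
  case (Suc n)
  then obtain q d where q: "q \<in> prefixes n" "d \<in> D" "p = int b * q + int d" by auto
  have "int b * (q + 1) \<le> int b * int b ^ n"
    using Suc.IH[OF q(1)] by (intro mult_left_mono) auto
  then show ?case using Suc.IH[OF q(1)] D_less[OF q(2)] q(3) by (simp add: algebra_simps)
qed simp

text \<open>The last digit is the residue modulo \<open>b\<close>, so appending digits is
  injective.\<close>

lemma card_prefixes: "card (prefixes n) = card D ^ n"
proof (induction n)
  case (Suc n)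
  have "inj_on (\<lambda>(p, d). int b * p + int d) (prefixes n \<times> D)"
  proof (rule inj_onI, clarify)
    fix p d q e
    assume "d \<in> D" "e \<in> D" and eq: "int b * p + int d = int b * q + int e"
    then have le: "d < b" "e < b" using D_less by auto
    have "(int b * p + int d) mod int b = int d" "(int b * q + int e) mod int b = int e"
      using le by simp_all
    then show "p = q \<and> d = e" using eq b_ge_2 by simp
  qed
  then show ?case using Suc by (simp add: card_image card_cartesian_product)
qed simp

lemma prefixes_add:
  "r \<in> prefixes (n + m) \<longleftrightarrow> (\<exists>p\<in>prefixes n. \<exists>q\<in>prefixes m. r = int b ^ m * p + q)"
proof (induction m arbitrary: r)
  case (Suc m)
  have "r \<in> prefixes (n + Suc m) \<longleftrightarrow>
      (\<exists>r'\<in>prefixes (n + m). \<exists>d\<in>D. r = int b * r' + int d)"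
    by auto
  also have "\<dots> \<longleftrightarrow> (\<exists>p\<in>prefixes n. \<exists>q\<in>prefixes m. \<exists>d\<in>D.
      r = int b * (int b ^ m * p + q) + int d)"
    by (simp only: Bex_def Suc) blast
  also have "\<dots> \<longleftrightarrow> (\<exists>p\<in>prefixes n. \<exists>q\<in>prefixes (Suc m). r = int b ^ Suc m * p + q)"
    by (fastforce simp: algebra_simps)
  finally show ?case .
qed simp

text \<open>The copy of \<open>K\<close> scaled by \<open>1 / B ^ n\<close> and placed at
  \<open>p / B ^ n\<close>. As a preimage under the zoom map it makes sense for every integer
  \<open>p\<close>, and zooming in is mere unfolding.\<close>

definition cyl :: "nat \<Rightarrow> int \<Rightarrow> real set" where
  "cyl n p = {x. B ^ n * x - of_int p \<in> K}"

lemma cyl_iff: "x \<in> cyl n p \<longleftrightarrow> (\<exists>k\<in>K. x = (k + of_int p) / B ^ n)"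
proof
  assume "x \<in> cyl n p"
  then show "\<exists>k\<in>K. x = (k + of_int p) / B ^ n"
    using B_pos by (intro bexI[of _ "B ^ n * x - of_int p"]) (auto simp: cyl_def)
qed (use B_pos in \<open>auto simp: cyl_def\<close>)

lemma cylI: "k \<in> K \<Longrightarrow> (k + of_int p) / B ^ n \<in> cyl n p"
  by (auto simp: cyl_iff)

lemma K_eq_UN_cyl: "K = (\<Union>p\<in>prefixes n. cyl n p)"
proof (induction n)
  case (Suc n)
  have "x \<in> K \<longleftrightarrow> (\<exists>p\<in>prefixes (Suc n). x \<in> cyl (Suc n) p)" for x
  proof -
    have "x \<in> K \<longleftrightarrow> (\<exists>p\<in>prefixes n. B ^ n * x - of_int p \<in> K)"
      by (subst Suc) (simp add: cyl_def)
    also have "\<dots> \<longleftrightarrow> (\<exists>p\<in>prefixes n. \<exists>d\<in>D. B * (B ^ n * x - of_int p) - real d \<in> K)"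
    proof (intro bex_cong refl iffI)
      fix p assume "B ^ n * x - of_int p \<in> K"
      then show "\<exists>d\<in>D. B * (B ^ n * x - of_int p) - real d \<in> K"
        using K_first_digit by metis
    next
      fix p assume "\<exists>d\<in>D. B * (B ^ n * x - of_int p) - real d \<in> K"
      then obtain d where "d \<in> D" "B * (B ^ n * x - of_int p) - real d \<in> K" by blast
      then show "B ^ n * x - of_int p \<in> K" 
        using K_prepend_digit[of "B * (B ^ n * x - of_int p) - real d" d] B_pos by simp
    qed
    also have "\<dots> \<longleftrightarrow> (\<exists>p\<in>prefixes (Suc n). x \<in> cyl (Suc n) p)"
      by (auto simp: cyl_def algebra_simps)
    finally show ?thesis .
  qed
  then show ?case by blast
qed (simp add: cyl_def)

lemma cyl_subset_K: "p \<in> prefixes n \<Longrightarrow> cyl n p \<subseteq> K"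
  using K_eq_UN_cyl by blast

lemma cyl_diameter: "x \<in> cyl n p \<Longrightarrow> y \<in> cyl n p \<Longrightarrow> \<bar>x - y\<bar> \<le> 1 / B ^ n"
proof -
  assume "x \<in> cyl n p" "y \<in> cyl n p"
  then obtain k l where "k \<in> K" "l \<in> K" "x = (k + of_int p) / B ^ n" "y = (l + of_int p) / B ^ n"
    by (auto simp: cyl_iff)
  moreover from this have "x - y = (k - l) / B ^ n" by (simp flip: diff_divide_distrib)
  moreover have "\<bar>k - l\<bar> \<le> 1" using K_bounds[OF \<open>k \<in> K\<close>] K_bounds[OF \<open>l \<in> K\<close>] by linarith
  ultimately show ?thesis using B_pos by (simp add: abs_divide divide_right_mono)
qed

text \<open>Integer translates of \<open>K\<close> lie in unit intervals that meet only at
  endpoints, so a point strictly inside one of these intervals determines the translate. This is why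
  copies are later compared only inside (0, 1).\<close>

lemma unit_interval_int_eq:
  assumes "x + of_int p - of_int q \<in> K" "0 < x" "x < (1::real)"
  shows "q = p"
proof -
  have "of_int (p - q) > (-1 :: real)" "of_int (p - q) < (1::real)"
    using K_bounds[OF assms(1)] assms(2,3) by auto
  then have "p - q > -1" "p - q < 1" by linarith+
  then show ?thesis by simp
qed

text \<open>A translate \<open>K + p\<close> can meet the interval only for \<open>p\<close> between
  \<open>a - 1\<close> and \<open>a + c\<close>, and a closed interval of length
  \<open>c + 1\<close> holds at most \<open>c + 2\<close> integers.\<close>

lemma card_int_near_interval:
  assumes "0 \<le> c" and S: "\<And>p::int. p \<in> S \<Longrightarrow> \<exists>y\<in>{a..a + c}. y - of_int p \<in> K"
  shows "finite S" and "real (card S) \<le> c + 2"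
proof -
  have sub: "S \<subseteq> {\<lceil>a - 1\<rceil>..\<lfloor>a + c\<rfloor>}"
  proof
    fix p assume "p \<in> S"
    then obtain y where "y \<in> {a..a + c}" "y - of_int p \<in> K" using S by blast
    moreover from this have "0 \<le> y - of_int p" "y - of_int p \<le> 1"
      using K_bounds[of "y - of_int p"] by auto
    ultimately show "p \<in> {\<lceil>a - 1\<rceil>..\<lfloor>a + c\<rfloor>}" by (simp add: ceiling_le_iff le_floor_iff del: ceiling_diff_one)
  qed
  then show "finite S" using finite_subset by blast
  have "card S \<le> nat (\<lfloor>a + c\<rfloor> + 1 - \<lceil>a - 1\<rceil>)"
    using card_mono[OF _ sub] by simp
  moreover have "real (nat (\<lfloor>a + c\<rfloor> + 1 - \<lceil>a - 1\<rceil>)) \<le> c + 2"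
  proof (cases "\<lfloor>a + c\<rfloor> + 1 - \<lceil>a - 1\<rceil> \<ge> 0")
    case True
    have "of_int \<lfloor>a + c\<rfloor> \<le> a + c" "a - 1 \<le> of_int \<lceil>a - 1\<rceil>" by linarith+
    then show ?thesis using True by linarith
  qed (use assms in simp)
  ultimately show "real (card S) \<le> c + 2" by linarith
qed

text \<open>A finite mass distribution principle behind all lower bounds. An interval of length
  \<open>c / B ^ n i\<close> meets at most \<open>c + 2\<close> cylinders of level
  \<open>n i\<close>, hence accounts for at most \<open>(c + 2) * card D ^ (N - n i)\<close>
  prefixes of a common level \<open>N\<close>, while all \<open>card D ^ N\<close> of them must be
  accounted for.\<close>

lemma weighted_cover_bound:
  fixes x :: "'i \<Rightarrow> real" and n :: "'i \<Rightarrow> nat"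
  assumes "finite F" "0 \<le> c" and cover: "K \<subseteq> (\<Union>i\<in>F. {x i..x i + c / B ^ n i})"
  shows "1 \<le> (\<Sum>i\<in>F. (c + 2) / real (card D) ^ n i)"
proof -
  define N where "N = Max (insert 0 (n ` F))"
  have nN: "n i \<le> N" if "i \<in> F" for i using that \<open>finite F\<close> by (auto simp: N_def)
  \<comment> \<open>Positions of the integer translates of \<open>K\<close> that meet the
    \<open>i\<close>-th interval once it is magnified by \<open>B ^ n i\<close>.\<close>
  define H where "H i = {p::int. \<exists>y. y \<in> {B ^ n i * x i..B ^ n i * x i + c} \<and> y - of_int p \<in> K}" for i
  have H: "finite (H i)" "real (card (H i)) \<le> c + 2" for i
  proof -
    have "\<exists>y\<in>{B ^ n i * x i..B ^ n i * x i + c}. y - of_int p \<in> K" if "p \<in> H i" for p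
      using that unfolding H_def by blast
    from card_int_near_interval[OF \<open>0 \<le> c\<close> this]
    show "finite (H i)" "real (card (H i)) \<le> c + 2" by blast+
  qed
  \<comment> \<open>Extensions of the positions in \<open>H i\<close> to level
    \<open>N\<close>.\<close>
  define E where "E i = (\<lambda>(p, q). int b ^ (N - n i) * p + q) ` (H i \<times> prefixes (N - n i))" for i
  have finE: "finite (E i)" for i using H finite_prefixes by (simp add: E_def)
  have "prefixes N \<subseteq> (\<Union>i\<in>F. E i)"
  proof
    fix r assume r: "r \<in> prefixes N"
    \<comment> \<open>A single point of \<open>K\<close>, moved into the cylinder of
      \<open>r\<close>, decides which interval accounts for \<open>r\<close>.\<close>
    obtain k where k: "k \<in> K" using K_nonempty by blast
    define z where "z = (k + of_int r) / B ^ N"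
    have "z \<in> cyl N r" using k by (auto simp: cyl_iff z_def)
    then have "z \<in> K" using cyl_subset_K[OF r] by blast
    then obtain i where i: "i \<in> F" "z \<in> {x i..x i + c / B ^ n i}" using cover by blast
    have "N = n i + (N - n i)" using nN[OF i(1)] by simp
    then have "r \<in> prefixes (n i + (N - n i))" using r by simp
    then obtain p q where pq: "p \<in> prefixes (n i)" "q \<in> prefixes (N - n i)"
      "r = int b ^ (N - n i) * p + q"
      unfolding prefixes_add by blast
    have BN: "B ^ N = B ^ n i * B ^ (N - n i)" using nN[OF i(1)] by (simp flip: power_add)
    have "B ^ n i * z - of_int p = (k + of_int q) / B ^ (N - n i)"
      unfolding z_def BN pq(3) using B_pos by (simp add: divide_simps)
    also have "\<dots> \<in> cyl (N - n i) q" using k by (auto simp: cyl_iff)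
    also have "\<dots> \<subseteq> K" by (rule cyl_subset_K[OF pq(2)])
    finally have "B ^ n i * z - of_int p \<in> K" .
    moreover have "B ^ n i * z \<in> {B ^ n i * x i..B ^ n i * x i + c}"
    proof -
      have "B ^ n i * z \<le> B ^ n i * (x i + c / B ^ n i)" "B ^ n i * x i \<le> B ^ n i * z"
        using i(2) B_pos by (auto intro!: mult_left_mono)
      moreover have "B ^ n i * (x i + c / B ^ n i) = B ^ n i * x i + c"
        using B_pos by (simp add: distrib_left)
      ultimately show ?thesis by simp
    qed
    ultimately have "p \<in> H i" unfolding H_def by blast
    then show "r \<in> (\<Union>i\<in>F. E i)" using pq i(1) by (auto simp: E_def)
  qed
  then have "card (prefixes N) \<le> card (\<Union>i\<in>F. E i)"
    using \<open>finite F\<close> finE by (intro card_mono) auto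
  also have "\<dots> \<le> (\<Sum>i\<in>F. card (E i))" by (rule card_UN_le[OF \<open>finite F\<close>])
  finally have "real (card D) ^ N \<le> (\<Sum>i\<in>F. real (card (E i)))"
    unfolding card_prefixes by (metis of_nat_le_iff of_nat_power of_nat_sum)
  also have "\<dots> \<le> (\<Sum>i\<in>F. real (card D) ^ N * ((c + 2) / real (card D) ^ n i))"
  proof (rule sum_mono)
    fix i assume "i \<in> F"
    have "card (E i) \<le> card (H i) * card D ^ (N - n i)"
      unfolding E_def using card_image_le[of "H i \<times> prefixes (N - n i)"] H finite_prefixes
      by (metis card_cartesian_product card_prefixes finite_cartesian_product)
    then have "real (card (E i)) \<le> real (card (H i)) * real (card D) ^ (N - n i)"
      by (metis of_nat_le_iff of_nat_mult of_nat_power)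
    also have "\<dots> \<le> (c + 2) * real (card D) ^ (N - n i)"
      using H by (intro mult_right_mono) auto
    also have "real (card D) ^ (N - n i) = real (card D) ^ N / real (card D) ^ n i"
      using nN[OF \<open>i \<in> F\<close>] card_D by (intro power_diff) auto
    finally show "real (card (E i)) \<le> real (card D) ^ N * ((c + 2) / real (card D) ^ n i)"
      by (simp add: mult_ac)
  qed
  also have "\<dots> = real (card D) ^ N * (\<Sum>i\<in>F. (c + 2) / real (card D) ^ n i)"
    by (simp add: sum_distrib_left)
  finally show ?thesis using card_D by simp
qed

subsection \<open>Full subsets and upper Minkowski dimension\<close>

text \<open>Pulls a cover of an affine copy of \<open>K\<close> back to a cover of \<open>K\<close>.
  For negative \<open>c\<close> the left endpoint of the preimage comes from the right endpoint
  \<open>x + \<delta>\<close>.\<close>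

lemma affine_vimage_interval:
  fixes c e x \<delta> :: real
  assumes "c \<noteq> 0"
  shows "\<exists>y. \<forall>k. x \<le> c * k + e \<longrightarrow> c * k + e \<le> x + \<delta> \<longrightarrow> k \<in> {y..y + \<delta> / \<bar>c\<bar>}"
proof (cases "0 < c")
  case True
  have "(x - e) / c \<le> k \<and> k \<le> (x - e) / c + \<delta> / \<bar>c\<bar>" if "x \<le> c * k + e" "c * k + e \<le> x + \<delta>" for k
    using that True by (simp add: field_simps)
  then show ?thesis by (intro exI[of _ "(x - e) / c"]) auto
next
  case False
  then have c: "c < 0" using assms by simp
  have "(x + \<delta> - e) / c \<le> k \<and> k \<le> (x + \<delta> - e) / c + \<delta> / \<bar>c\<bar>"
    if "x \<le> c * k + e" "c * k + e \<le> x + \<delta>" for k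
  proof -
    have "(x + \<delta> - e) / c + \<delta> / \<bar>c\<bar> = (x - e) / c"
      using c by (simp add: add_divide_distrib diff_divide_distrib)
    then show ?thesis using that c by (simp add: neg_divide_le_eq neg_le_divide_eq mult.commute)
  qed
  then show ?thesis by (intro exI[of _ "(x + \<delta> - e) / c"]) auto
qed

lemma cyl_add: "x \<in> cyl (n + m) (int b ^ m * p + q) \<longleftrightarrow> B ^ n * x - of_int p \<in> cyl m q"
proof -
  have "B ^ (n + m) * x - of_int (int b ^ m * p + q) = B ^ m * (B ^ n * x - of_int p) - of_int q"
    by (simp add: power_add algebra_simps)
  then show ?thesis unfolding cyl_def by (simp only: mem_Collect_eq)
qed

text \<open>The level \<open>n\<close> is left free so that failure for a single \<open>m\<close>
  removes a descendant from every cylinder of every level, a loss that compounds.\<close>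

definition full :: "real set \<Rightarrow> nat \<Rightarrow> bool" where
  "full X m \<longleftrightarrow> (\<exists>n. \<exists>p\<in>prefixes n. \<forall>q\<in>prefixes m. X \<inter> cyl (n + m) (int b ^ m * p + q) \<noteq> {})"

definition hit :: "real set \<Rightarrow> nat \<Rightarrow> int set" where
  "hit X n = {p \<in> prefixes n. X \<inter> cyl n p \<noteq> {}}"

lemma finite_hit: "finite (hit X n)"
  using finite_prefixes by (simp add: hit_def)

text \<open>Passing \<open>m\<close> generations down, each cylinder that is hit has at least one
  descendant that is missed, so the count grows by a factor of at most
  \<open>card D ^ m - 1\<close>.\<close>

lemma card_hit_le:
  assumes "\<not> full X m"
  shows "card (hit X (k * m)) \<le> (card D ^ m - 1) ^ k"
proof (induction k)
  case 0
  have "hit X 0 \<subseteq> {0}" by (auto simp: hit_def)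
  then show ?case using card_mono[of "{0::int}"] by fastforce
next
  case (Suc k)
  define E where "E p = {q \<in> prefixes m. X \<inter> cyl (k * m + m) (int b ^ m * p + q) \<noteq> {}}" for p
  define G where "G p = (\<lambda>q. int b ^ m * p + q) ` E p" for p
  have finE: "finite (E p)" for p using finite_prefixes by (simp add: E_def)
  have "hit X (k * m + m) \<subseteq> (\<Union>p\<in>hit X (k * m). G p)"
  proof
    fix r assume "r \<in> hit X (k * m + m)"
    then have r: "r \<in> prefixes (k * m + m)" "X \<inter> cyl (k * m + m) r \<noteq> {}" by (auto simp: hit_def)
    from r(1) obtain p q where pq: "p \<in> prefixes (k * m)" "q \<in> prefixes m" "r = int b ^ m * p + q"
      unfolding prefixes_add by blast
    obtain x where x: "x \<in> X" "x \<in> cyl (k * m + m) r" using r(2) by blast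
    then have "B ^ (k * m) * x - of_int p \<in> K"
      unfolding pq(3) cyl_add using cyl_subset_K[OF pq(2)] by blast
    then have "p \<in> hit X (k * m)" using pq(1) x by (auto simp: hit_def cyl_def)
    moreover have "q \<in> E p" using pq x by (auto simp: E_def)
    ultimately show "r \<in> (\<Union>p\<in>hit X (k * m). G p)" using pq(3) by (auto simp: G_def)
  qed
  then have "card (hit X (k * m + m)) \<le> card (\<Union>p\<in>hit X (k * m). G p)"
    using finite_hit finE by (intro card_mono) (auto simp: G_def)
  also have "\<dots> \<le> (\<Sum>p\<in>hit X (k * m). card (G p))" by (rule card_UN_le[OF finite_hit])
  also have "\<dots> \<le> (\<Sum>p\<in>hit X (k * m). card D ^ m - 1)"
  proof (rule sum_mono)
    fix p assume "p \<in> hit X (k * m)"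
    then have "p \<in> prefixes (k * m)" by (simp add: hit_def)
    then have "E p \<noteq> prefixes m" using assms unfolding full_def E_def by blast
    then have "E p \<subset> prefixes m" by (auto simp: E_def)
    then have "card (E p) < card D ^ m"
      using psubset_card_mono[OF finite_prefixes] by (simp add: card_prefixes)
    moreover have "card (G p) \<le> card (E p)" unfolding G_def by (rule card_image_le[OF finE])
    ultimately show "card (G p) \<le> card D ^ m - 1" by simp
  qed
  also have "\<dots> = card (hit X (k * m)) * (card D ^ m - 1)" by simp
  also have "\<dots> \<le> (card D ^ m - 1) ^ k * (card D ^ m - 1)"
    using Suc by (rule mult_right_mono) simp
  finally show ?case by (simp add: add.commute mult.commute)
qed

lemma cyl_subset_interval:
  assumes "1 / B ^ n \<le> \<delta>"
  shows "cyl n p \<subseteq> {of_int p / B ^ n..of_int p / B ^ n + \<delta>}"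
proof
  fix x assume "x \<in> cyl n p"
  then obtain k where k: "k \<in> K" "x = (k + of_int p) / B ^ n" by (auto simp: cyl_iff)
  have "0 \<le> k / B ^ n" "k / B ^ n \<le> 1 / B ^ n"
    using K_bounds[OF k(1)] B_pos by (auto intro: divide_right_mono)
  then show "x \<in> {of_int p / B ^ n..of_int p / B ^ n + \<delta>}"
    using assms by (simp add: k(2) add_divide_distrib)
qed

lemma hit_cover:
  assumes "X \<subseteq> K" "1 / B ^ n \<le> \<delta>"
  shows "X \<subseteq> (\<Union>x\<in>(\<lambda>p. of_int p / B ^ n) ` hit X n. {x..x + \<delta>})"
proof
  fix x assume "x \<in> X"
  then obtain p where "p \<in> prefixes n" "x \<in> cyl n p" using assms(1) K_eq_UN_cyl by blast
  then have "p \<in> hit X n" "x \<in> {of_int p / B ^ n..of_int p / B ^ n + \<delta>}"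
    using \<open>x \<in> X\<close> cyl_subset_interval[OF assms(2), of p] by (auto simp: hit_def)
  then show "x \<in> (\<Union>x\<in>(\<lambda>p. of_int p / B ^ n) ` hit X n. {x..x + \<delta>})" by blast
qed

lemma covering_number_le_card:
  "finite C \<Longrightarrow> A \<subseteq> (\<Union>x\<in>C. {x..x + \<delta>}) \<Longrightarrow> covering_number \<delta> A \<le> card C"
  unfolding covering_number_def by (rule Least_le) blast

lemma covering_number_le_hit:
  assumes "X \<subseteq> K" "1 / B ^ n \<le> \<delta>"
  shows "covering_number \<delta> X \<le> card (hit X n)"
  using covering_number_le_card[OF _ hit_cover[OF assms]]
    card_image_le[OF finite_hit, of "\<lambda>p. of_int p / B ^ n" X n] finite_hit[of X n]
  by simp

lemma covering_number_attained:
  assumes "X \<subseteq> K" "0 < \<delta>"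
  obtains C where "finite C" "card C = covering_number \<delta> X" "X \<subseteq> (\<Union>x\<in>C. {x..x + \<delta>})"
proof -
  obtain n where "1 / \<delta> < B ^ n" using B_power_unbounded by blast
  then have "1 / B ^ n \<le> \<delta>" using assms(2) B_pos by (simp add: field_simps)
  from hit_cover[OF assms(1) this] finite_hit
  have "\<exists>m C. finite C \<and> card C = m \<and> X \<subseteq> (\<Union>x\<in>C. {x..x + \<delta>})"
    by (meson finite_imageI)
  from LeastI_ex[OF this, folded covering_number_def] show thesis using that by (elim exE conjE)
qed

text \<open>The similarity dimension: the \<open>s\<close> with
  \<open>card D * B powr (- s) = 1\<close>.\<close>

definition sdim :: real where "sdim = ln (real (card D)) / ln B"

lemma ln_B_pos: "0 < ln B"
  using B_gt_1 by simp

lemma ln_card_D: "ln (real (card D)) = sdim * ln B"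
  using ln_B_pos by (simp add: sdim_def)

lemma sdim_pos: "0 < sdim"
  using card_D ln_B_pos by (simp add: sdim_def)

text \<open>With \<open>M = card D ^ m - 1\<close>, at most \<open>M ^ k\<close> intervals of length
  \<open>1 / B ^ (k * m)\<close> are needed, which bounds the dimension by
  \<open>ln M / (m * ln B)\<close>. This is below \<open>sdim\<close> because
  \<open>M < card D ^ m\<close>.\<close>

lemma upper_minkowski_dim_less_if_not_full:
  assumes "X \<subseteq> K" "\<not> full X m"
  shows "upper_minkowski_dim X < ereal sdim"
proof (cases "X = {}")
  case True
  then show ?thesis using sdim_pos by (simp add: upper_minkowski_dim_def)
next
  case False
  then obtain x where x: "x \<in> X" by blast
  \<comment> \<open>For \<open>m = 0\<close> every nonempty subset of \<open>K\<close> is full,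
    since \<open>cyl 0 0\<close> is \<open>K\<close>.\<close>
  have "m \<noteq> 0"
  proof
    assume "m = 0"
    moreover have "x \<in> cyl 0 0" using x assms(1) by (auto simp: cyl_def)
    ultimately have "full X m" unfolding full_def
      by (intro exI[of _ 0] bexI[of _ 0]) (use x in auto)
    then show False using assms(2) by simp
  qed
  define M where "M = card D ^ m - 1"
  define L where "L = ln (real M)"
  define c where "c = real m * ln B"
  have "card D ^ 1 \<le> card D ^ m"
    using card_D \<open>m \<noteq> 0\<close> by (intro power_increasing) auto
  then have "2 \<le> card D ^ m" using card_D by simp
  then have M: "1 \<le> M" "real M < real (card D) ^ m" by (simp_all add: M_def of_nat_diff)
  have L0: "0 \<le> L" using M by (simp add: L_def)
  have c0: "0 < c" using \<open>m \<noteq> 0\<close> ln_B_pos by (simp add: c_def)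
  have "L < ln (real (card D) ^ m)" unfolding L_def using M by (intro ln_less_cancel_iff[THEN iffD2]) linarith+
  also have "\<dots> = sdim * c" using card_D by (simp add: ln_realpow ln_card_D c_def)
  finally have Lc: "L / c < sdim" using c0 by (simp add: field_simps)
  then obtain r where r: "L / c < r" "r < sdim" using dense by blast
  \<comment> \<open>For \<open>\<delta>\<close> below \<open>exp (- y)\<close> the distance from
    \<open>L / c\<close> to \<open>r\<close> pays for the extra factor \<open>M\<close> lost when
    \<open>k\<close> is rounded up.\<close>
  define y where "y = max 1 (L / (r - L / c))"
  have bound: "ln (real (covering_number \<delta> X)) / - ln \<delta> \<le> r" if "\<delta> \<in> {0<..<exp (- y)}" for \<delta>
  proof -
    have d: "0 < \<delta>" "y < - ln \<delta>"
      using that ln_less_cancel_iff[of \<delta> "exp (- y)"] by (auto simp del: ln_less_cancel_iff)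
    define t where "t = - ln \<delta>"
    have t: "y < t" "1 < t" "\<delta> = exp (- t)" using d by (simp_all add: t_def y_def)
    \<comment> \<open>The first multiple of \<open>m\<close> whose cylinders are no longer than
      \<open>\<delta>\<close> is \<open>k * m\<close>.\<close>
    define k where "k = nat \<lceil>t / c\<rceil>"
    have "0 \<le> t / c" using t c0 by simp
    then have k: "t / c \<le> real k" "real k \<le> t / c + 1"
      unfolding k_def by linarith+
    have "t \<le> real k * c" using k(1) c0 by (simp add: field_simps)
    then have "exp (- (real k * c)) \<le> \<delta>" using t(3) by simp
    also have "exp (- (real k * c)) = 1 / B ^ (k * m)"
    proof -
      have "exp (real k * c) = B ^ (k * m)"
        using B_pos exp_of_nat_mult[of "k * m" "ln B"] by (simp add: c_def mult.assoc)
      then show ?thesis by (simp add: exp_minus inverse_eq_divide)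
    qed
    finally have "1 / B ^ (k * m) \<le> \<delta>" .
    from covering_number_le_hit[OF assms(1) this] card_hit_le[OF assms(2), of k]
    have "covering_number \<delta> X \<le> M ^ k" by (simp add: M_def)
    \<comment> \<open>The case split concerns the value \<open>ln 0 = 0\<close>, which
      \<open>0 \<le> L\<close> takes care of.\<close>
    then have "ln (real (covering_number \<delta> X)) \<le> real k * L"
    proof (cases "covering_number \<delta> X = 0")
      case False
      then have "ln (real (covering_number \<delta> X)) \<le> ln (real (M ^ k))"
        using \<open>covering_number \<delta> X \<le> M ^ k\<close> by (intro ln_mono) auto
      then show ?thesis using M by (simp add: L_def ln_realpow)
    qed (use L0 in simp)
    also have "\<dots> \<le> (t / c + 1) * L" using k(2) L0 by (rule mult_right_mono)
    also have "\<dots> \<le> r * t"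
    proof -
      have "L / (r - L / c) \<le> t" using t by (simp add: y_def)
      then have "L \<le> t * (r - L / c)" using r by (simp add: pos_divide_le_eq)
      then show ?thesis by (simp add: algebra_simps)
    qed
    finally show ?thesis using t by (simp flip: t_def add: pos_divide_le_eq)
  qed
  have "\<forall>\<^sub>F \<delta> in at_right 0. ereal (ln (real (covering_number \<delta> X)) / - ln \<delta>) \<le> ereal r"
    using eventually_at_right_real[OF exp_gt_zero[of "- y"]]
    by (rule eventually_mono) (use bound in \<open>simp only: ereal_less_eq\<close>)
  then have "upper_minkowski_dim X \<le> ereal r"
    unfolding upper_minkowski_dim_def using False Limsup_bounded by (simp only: if_False)
  also have "ereal r < ereal sdim" using r by simp
  finally show ?thesis .
qed

text \<open>A cover of \<open>A\<close> pulls back to a cover of \<open>K\<close>, so at scale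
  \<open>\<bar>c\<bar> / B ^ n\<close> at least \<open>card D ^ n / 3\<close> intervals are needed.
  A dimension below \<open>sdim\<close> would contradict this growth.\<close>

lemma upper_minkowski_dim_ge_if_affine_copy:
  assumes "A \<subseteq> K" "c \<noteq> 0" and copy: "(\<lambda>x. c * x + e) ` K \<subseteq> A"
  shows "ereal sdim \<le> upper_minkowski_dim A"
proof (rule ccontr)
  assume "\<not> ereal sdim \<le> upper_minkowski_dim A"
  then have "upper_minkowski_dim A < ereal sdim" by simp
  then obtain r where r: "upper_minkowski_dim A < ereal r" "ereal r < ereal sdim"
    using ereal_dense2 by blast
  have "A \<noteq> {}" using copy K_nonempty by blast
  then have ev: "eventually (\<lambda>\<delta>. ereal (ln (real (covering_number \<delta> A)) / - ln \<delta>) < ereal r) (at_right 0)"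
    using Limsup_lessD[of "at_right 0" _ "ereal r"] r(1) unfolding upper_minkowski_dim_def
    by (simp del: less_ereal.simps)
  \<comment> \<open>Scaled so that the pulled-back intervals have length exactly
    \<open>1 / B ^ n\<close>; the constant in \<open>weighted_cover_bound\<close> is then 1 + 2 =
    3.\<close>
  define \<delta> where "\<delta> n = \<bar>c\<bar> / B ^ n" for n
  have \<delta>_pos: "0 < \<delta> n" for n using assms(2) B_pos by (simp add: \<delta>_def)
  have lim: "\<delta> \<longlonglongrightarrow> 0" unfolding \<delta>_def by (rule tendsto_inverse_B_power)
  then have "filterlim \<delta> (at_right 0) sequentially"
    using \<delta>_pos by (simp add: filterlim_at less_imp_neq[symmetric])
  then have ev1: "\<forall>\<^sub>F n in sequentially. ln (real (covering_number (\<delta> n) A)) / - ln (\<delta> n) < r"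
    using ev by (auto simp: filterlim_iff)
  have ev2: "\<forall>\<^sub>F n in sequentially. \<delta> n < 1"
    using lim by (rule order_tendstoD) simp
  have lower: "real n * ln (real (card D)) - ln 3 \<le> ln (real (covering_number (\<delta> n) A))" for n
  proof -
    obtain C where C: "finite C" "card C = covering_number (\<delta> n) A" "A \<subseteq> (\<Union>x\<in>C. {x..x + \<delta> n})"
      using covering_number_attained[OF assms(1) \<delta>_pos] by blast
    have "\<exists>y. \<forall>k. x \<le> c * k + e \<longrightarrow> c * k + e \<le> x + \<delta> n \<longrightarrow> k \<in> {y..y + 1 / B ^ n}" for x
      using affine_vimage_interval[OF assms(2), of x e "\<delta> n"] assms(2) by (simp add: \<delta>_def)
    then obtain g where g: "\<And>x k. x \<le> c * k + e \<Longrightarrow> c * k + e \<le> x + \<delta> n \<Longrightarrow> k \<in> {g x..g x + 1 / B ^ n}"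
      by metis
    have "K \<subseteq> (\<Union>x\<in>C. {g x..g x + 1 / B ^ n})"
    proof
      fix k assume "k \<in> K"
      then have "c * k + e \<in> (\<Union>x\<in>C. {x..x + \<delta> n})" using copy C(3) by blast
      then show "k \<in> (\<Union>x\<in>C. {g x..g x + 1 / B ^ n})" using g by fastforce
    qed
    from weighted_cover_bound[OF C(1) _ this]
    have "1 \<le> real (card C) * (3 / real (card D) ^ n)" by simp
    moreover have "0 < real (card D) ^ n" using card_D by simp
    ultimately have *: "real (card D) ^ n \<le> 3 * real (card C)" by (simp add: field_simps)
    then have "0 < real (card C)" using \<open>0 < real (card D) ^ n\<close> by linarith
    then have "ln (3 * real (card C)) = ln 3 + ln (real (card C))" by (intro ln_mult_pos) auto
    moreover have "ln (real (card D) ^ n) \<le> ln (3 * real (card C))"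
      using * \<open>0 < real (card D) ^ n\<close> by (intro ln_mono) auto
    ultimately have "ln (real (card D) ^ n) \<le> ln 3 + ln (real (card C))" by simp
    then show ?thesis using card_D C(2) by (simp add: ln_realpow)
  qed
  \<comment> \<open>The logarithmic surplus per level: the number of intervals must grow by the
    factor \<open>card D\<close>, while the assumed bound allows only
    \<open>B powr r\<close>.\<close>
  define \<theta> where "\<theta> = ln (real (card D)) - r * ln B"
  have "0 < \<theta>" using r(2) ln_B_pos by (simp add: \<theta>_def ln_card_D)
  define w where "w = ln 3 - r * ln \<bar>c\<bar>"
  have "\<forall>\<^sub>F n in sequentially. real n * \<theta> < w"
    using ev1 ev2
  proof eventually_elim
    case (elim n)
    have "0 < - ln (\<delta> n)" using elim(2) \<delta>_pos[of n] by simp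
    then have "ln (real (covering_number (\<delta> n) A)) < r * - ln (\<delta> n)"
      using elim(1) by (simp only: pos_divide_less_eq)
    moreover have "ln (\<delta> n) = ln \<bar>c\<bar> - real n * ln B"
      using assms(2) B_pos by (simp add: \<delta>_def ln_div ln_realpow)
    ultimately show ?case using lower[of n] by (simp add: \<theta>_def w_def algebra_simps)
  qed
  then obtain N where N: "\<And>n. n \<ge> N \<Longrightarrow> real n * \<theta> < w" by (auto simp: eventually_sequentially)
  obtain n where "w < real n * \<theta>" using reals_Archimedean3[OF \<open>0 < \<theta>\<close>] by blast
  moreover have "real n * \<theta> \<le> real (max n N) * \<theta>" using \<open>0 < \<theta>\<close> by simp
  ultimately show False using N[of "max n N"] by simp
qed

lemma B_powr_sdim: "B powr sdim = real (card D)"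
  using B_pos card_D by (simp add: powr_def ln_card_D[symmetric])

lemma B_power_powr: "(B ^ n) powr s = (B powr s) ^ n"
  using B_pos by (simp add: powr_powr mult.commute flip: powr_realpow)

lemma inverse_B_power_powr_sdim: "(1 / B ^ n) powr sdim = 1 / real (card D) ^ n"
  by (simp add: powr_divide B_power_powr B_powr_sdim)

subsection \<open>Hausdorff dimension\<close>

text \<open>The cover by the level-\<open>n\<close> cylinders costs at most
  \<open>(card D / B powr s) ^ n\<close>, and this ratio is below 1 for \<open>s\<close> above
  \<open>sdim\<close>.\<close>

lemma hausdorff_measure_K_eq_0:
  assumes "sdim < s"
  shows "hausdorff_measure s K = 0"
proof -
  have s: "0 < s" using sdim_pos assms by simp
  have "hausdorff_premeasure s \<delta> K \<le> 0" if "0 < \<delta>" for \<delta>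
  proof (rule ennreal_le_epsilon)
    fix e :: real assume "0 < e"
    define \<rho> where "\<rho> = real (card D) / B powr s"
    have "\<rho> < 1" "0 \<le> \<rho>"
      using powr_less_mono[OF assms B_gt_1] B_pos by (simp_all add: \<rho>_def B_powr_sdim)
    then have "(\<lambda>n. \<rho> ^ n) \<longlonglongrightarrow> 0" by (intro LIMSEQ_realpow_zero)
    then have "\<forall>\<^sub>F n in sequentially. \<rho> ^ n < e" using \<open>0 < e\<close> by (rule order_tendstoD)
    moreover have "\<forall>\<^sub>F n in sequentially. 1 / B ^ n < \<delta>"
      using tendsto_inverse_B_power \<open>0 < \<delta>\<close> by (rule order_tendstoD)
    ultimately have "\<forall>\<^sub>F n in sequentially. \<rho> ^ n < e \<and> 1 / B ^ n < \<delta>" by (rule eventually_conj)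
    then obtain n where n: "\<rho> ^ n < e" "1 / B ^ n < \<delta>" by (auto simp: eventually_sequentially)
    obtain h :: "nat \<Rightarrow> int" where h: "prefixes n = h ` {i. i < card (prefixes n)}"
      using finite_imp_nat_seg_image_inj_on[OF finite_prefixes[of n]] card_image[of _ "{i. i < _}"]
      by (metis card_Collect_less_nat)
    define N where "N = card (prefixes n)"
    \<comment> \<open>Covers are infinite sequences, so the finite list of cylinders is padded with
      empty sets, on which \<open>diam_power\<close> vanishes.\<close>
    define U where "U i = (if i < N then cyl n (h i) else {})" for i
    have Ubd: "bounded (U i)" for i
    proof (rule bounded_subset)
      show "U i \<subseteq> K" using h cyl_subset_K by (auto simp: U_def N_def)
    qed (rule compact_imp_bounded[OF K_compact])
    have Udi: "diameter (U i) \<le> 1 / B ^ n" for i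
    proof (rule diameter_le)
      show "norm (x - y) \<le> 1 / B ^ n" if "x \<in> U i" "y \<in> U i" for x y
        using that cyl_diameter[of x n "h i" y] by (simp add: U_def split: if_splits)
    qed (use B_pos in simp)
    have "K \<subseteq> (\<Union>i. U i)"
    proof
      fix x assume "x \<in> K"
      then obtain p where "p \<in> prefixes n" "x \<in> cyl n p" using K_eq_UN_cyl by blast
      then obtain i where "i < N" "p = h i" using h by (auto simp: N_def)
      then have "x \<in> U i" using \<open>x \<in> cyl n p\<close> by (simp add: U_def)
      then show "x \<in> (\<Union>i. U i)" by blast
    qed
    then have "hausdorff_premeasure s \<delta> K \<le> (\<Sum>i. ennreal (diam_power s (U i)))"
      unfolding hausdorff_premeasure_def
      using Ubd order_trans[OF Udi less_imp_le[OF n(2)]] by (intro INF_lower) auto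
    also have "\<dots> = (\<Sum>i<N. ennreal (diam_power s (U i)))"
      by (rule suminf_finite) (auto simp: U_def diam_power_def)
    also have "\<dots> \<le> (\<Sum>i<N. ennreal ((1 / B ^ n) powr s))"
    proof (intro sum_mono ennreal_leI)
      fix i
      have "diameter (U i) powr s \<le> (1 / B ^ n) powr s"
        using Udi Ubd diameter_ge_0 s by (intro powr_mono2) auto
      then show "diam_power s (U i) \<le> (1 / B ^ n) powr s" using s by (simp add: diam_power_def)
    qed
    also have "\<dots> = ennreal (real N * (1 / B ^ n) powr s)"
      by (simp add: ennreal_mult' ennreal_of_nat_eq_real_of_nat)
    also have "real N * (1 / B ^ n) powr s = \<rho> ^ n"
      by (simp add: N_def card_prefixes \<rho>_def powr_divide power_divide B_power_powr)
    also have "ennreal (\<rho> ^ n) \<le> 0 + ennreal e" using n(1) by (simp add: ennreal_leI)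
    finally show "hausdorff_premeasure s \<delta> K \<le> 0 + ennreal e" .
  qed
  then have "hausdorff_measure s K \<le> 0"
    unfolding hausdorff_measure_def by (intro SUP_least) auto
  then show ?thesis by simp
qed

text \<open>Rounds a length up to a power of \<open>1 / b\<close> at the cost of a factor
  \<open>b\<close>: the level just before the first one whose cylinder length drops below
  \<open>\<rho>\<close>. It exists because \<open>\<rho> < 1\<close> excludes level 0.\<close>

lemma exists_scale:
  assumes "0 < \<rho>" "\<rho> < 1"
  obtains n where "\<rho> \<le> 1 / B ^ n" "1 / B ^ n \<le> B * \<rho>"
proof -
  define n where "n = (LEAST n. 1 / B ^ n < \<rho>)"
  have "\<exists>n. 1 / B ^ n < \<rho>"
    using order_tendstoD(2)[OF tendsto_inverse_B_power[of 1] assms(1)]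
    by (auto simp: eventually_sequentially)
  then have n: "1 / B ^ n < \<rho>" unfolding n_def by (rule LeastI_ex)
  then obtain m where m: "n = Suc m" using assms by (cases n) auto
  then have "\<not> 1 / B ^ m < \<rho>" using not_less_Least[of m "\<lambda>n. 1 / B ^ n < \<rho>"] by (simp add: n_def)
  moreover have "1 / B ^ m \<le> B * \<rho>" using n B_pos by (simp add: m field_simps)
  ultimately show thesis using that[of m] by simp
qed

text \<open>A cheap cover is fattened to open intervals, thinned to a finite one by compactness, and
  its lengths are rounded to powers of \<open>1 / b\<close>. It then violates
  \<open>weighted_cover_bound\<close>.\<close>

lemma hausdorff_measure_K_neq_0:
  assumes "0 \<le> s" "s < sdim"
  shows "hausdorff_measure s K \<noteq> 0"
proof
  assume "hausdorff_measure s K = 0"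
  moreover have "hausdorff_premeasure s 1 K \<le> hausdorff_measure s K"
    unfolding hausdorff_measure_def by (rule SUP_upper) simp
  ultimately have pre0: "hausdorff_premeasure s 1 K = 0" by simp
  \<comment> \<open>Chosen so that the final estimate
    \<open>4 * card D * (\<kappa> + \<kappa>)\<close> equals 1/2.\<close>
  define \<kappa> where "\<kappa> = 1 / (16 * real (card D))"
  have \<kappa>: "0 < \<kappa>" "\<kappa> < 1 / 2" using card_D by (simp_all add: \<kappa>_def field_simps)
  have "hausdorff_premeasure s 1 K < ennreal \<kappa>" using pre0 \<kappa> by simp
  then obtain U :: "nat \<Rightarrow> real set" where U: "K \<subseteq> (\<Union>i. U i)" "\<And>i. bounded (U i)" "\<And>i. diameter (U i) \<le> 1"
    and Usum: "(\<Sum>i. ennreal (diam_power s (U i))) < ennreal \<kappa>"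
    unfolding hausdorff_premeasure_def INF_less_iff by blast
  define d where "d i = diameter (U i)" for i
  have d: "0 \<le> d i" "d i \<le> 1" for i using U diameter_ge_0 by (auto simp: d_def)
  \<comment> \<open>Diameters at most 1 make the larger exponent cheaper. The case
    \<open>s = 0\<close> is separate because \<open>diam_power\<close> is then 1, whereas
    \<open>0 powr 0 = 0\<close>.\<close>
  have d_le: "d i powr sdim \<le> diam_power s (U i)" for i
  proof (cases "U i = {}")
    case False
    show ?thesis
    proof (cases "s = 0")
      case True
      then show ?thesis using False d[of i] sdim_pos by (simp add: diam_power_def powr_le1)
    next
      case nz: False
      have "d i powr sdim \<le> d i powr s" using d[of i] assms by (intro powr_mono') auto
      then show ?thesis using False nz by (simp add: diam_power_def d_def)
    qed
  qed (simp add: diam_power_def d_def)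
  have part: "(\<Sum>i\<in>F. d i powr sdim) < \<kappa>" if "finite F" for F
  proof -
    have "ennreal (\<Sum>i\<in>F. d i powr sdim) = (\<Sum>i\<in>F. ennreal (d i powr sdim))" by simp
    also have "\<dots> \<le> (\<Sum>i\<in>F. ennreal (diam_power s (U i)))" by (intro sum_mono ennreal_leI d_le)
    also have "\<dots> \<le> (\<Sum>i. ennreal (diam_power s (U i)))" using that by (intro sum_le_suminf) auto
    also have "\<dots> < ennreal \<kappa>" by (rule Usum)
    finally show ?thesis by (simp add: ennreal_less_iff sum_nonneg)
  qed
  \<comment> \<open>Summable slack of total \<open>\<kappa>\<close>, giving room to every set,
    including those of diameter 0.\<close>
  define \<eta> where "\<eta> i = \<kappa> * (1 / 2) ^ Suc i" for i
  have \<eta>_pos: "0 < \<eta> i" for i using \<kappa> by (simp add: \<eta>_def)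
  have \<eta>_sum: "(\<Sum>i\<in>F. \<eta> i) \<le> \<kappa>" if "finite F" for F
  proof -
    have "\<eta> sums (\<kappa> * 1)" unfolding \<eta>_def by (intro sums_mult power_half_series)
    then show ?thesis using sum_le_suminf[of \<eta> F] that \<eta>_pos less_imp_le[OF \<eta>_pos] by (simp add: sums_iff)
  qed
  \<comment> \<open>The enlarged radius for which the cost at exponent \<open>sdim\<close> grows by
    exactly \<open>\<eta> i\<close>.\<close>
  define \<rho> where "\<rho> i = (d i powr sdim + \<eta> i) powr (1 / sdim)" for i
  have pos: "0 < d i powr sdim + \<eta> i" for i using \<eta>_pos[of i] by (simp add: add_nonneg_pos)
  have \<rho>_powr: "\<rho> i powr sdim = d i powr sdim + \<eta> i" for i
    using pos[of i] sdim_pos by (simp add: \<rho>_def powr_powr)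
  have \<rho>_pos: "0 < \<rho> i" for i using pos[of i] by (simp add: \<rho>_def)
  have \<rho>_gt: "d i < \<rho> i" for i
  proof (rule ccontr)
    assume "\<not> d i < \<rho> i"
    then have "\<rho> i powr sdim \<le> d i powr sdim" using \<rho>_pos[of i] sdim_pos by (intro powr_mono2) auto
    then show False using \<rho>_powr[of i] \<eta>_pos[of i] by simp
  qed
  have \<rho>_less: "\<rho> i < 1" for i
  proof (rule ccontr)
    assume "\<not> \<rho> i < 1"
    then have "1 \<le> \<rho> i powr sdim" using sdim_pos by (simp add: ge_one_powr_ge_zero)
    then show False using \<rho>_powr[of i] part[of "{i}"] \<eta>_sum[of "{i}"] \<kappa> by simp
  qed
  obtain n where n: "\<And>i. \<rho> i \<le> 1 / B ^ n i" "\<And>i. 1 / B ^ n i \<le> B * \<rho> i"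
  proof -
    have "\<forall>i. \<exists>n. \<rho> i \<le> 1 / B ^ n \<and> 1 / B ^ n \<le> B * \<rho> i"
      using exists_scale[OF \<rho>_pos \<rho>_less] by blast
    then show thesis using that by metis
  qed
  \<comment> \<open>For empty \<open>U i\<close> the choice is arbitrary and the inclusion below is
    trivial.\<close>
  define x where "x i = (SOME y. y \<in> U i)" for i
  have Uin: "U i \<subseteq> {x i - \<rho> i<..<x i + \<rho> i}" for i
  proof
    fix y assume y: "y \<in> U i"
    then have "x i \<in> U i" unfolding x_def by (rule someI)
    then have "dist y (x i) \<le> d i" using y diameter_bounded_bound[OF U(2)] by (simp add: d_def)
    then have "dist y (x i) < \<rho> i" using \<rho>_gt[of i] by linarith
    then show "y \<in> {x i - \<rho> i<..<x i + \<rho> i}" by (auto simp: dist_real_def)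
  qed
  have "K \<subseteq> (\<Union>i\<in>UNIV. {x i - \<rho> i<..<x i + \<rho> i})" using U(1) Uin by blast
  then obtain F where F: "finite F" "K \<subseteq> (\<Union>i\<in>F. {x i - \<rho> i<..<x i + \<rho> i})"
    by (rule compactE_image[OF K_compact, rotated]) auto
  \<comment> \<open>Each interval has length \<open>2 * \<rho> i\<close>, at most
    \<open>2 / B ^ n i\<close>; hence \<open>c = 2\<close> and the factor 4 below.\<close>
  have "K \<subseteq> (\<Union>i\<in>F. {(x i - \<rho> i)..(x i - \<rho> i) + 2 / B ^ n i})"
  proof -
    have "{x i - \<rho> i<..<x i + \<rho> i} \<subseteq> {(x i - \<rho> i)..(x i - \<rho> i) + 2 / B ^ n i}" for i
      using n(1)[of i] by auto
    then show ?thesis using F(2) by blast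
  qed
  from weighted_cover_bound[OF F(1) _ this]
  have "1 \<le> (\<Sum>i\<in>F. 4 * (1 / real (card D) ^ n i))" by simp
  also have "\<dots> \<le> (\<Sum>i\<in>F. 4 * (real (card D) * (d i powr sdim + \<eta> i)))"
  proof (intro sum_mono mult_left_mono)
    fix i
    have "1 / real (card D) ^ n i = (1 / B ^ n i) powr sdim" by (simp add: inverse_B_power_powr_sdim)
    also have "\<dots> \<le> (B * \<rho> i) powr sdim" using n(2) B_pos sdim_pos by (intro powr_mono2) auto
    also have "\<dots> = real (card D) * (d i powr sdim + \<eta> i)"
      by (simp add: powr_mult B_powr_sdim \<rho>_powr)
    finally show "1 / real (card D) ^ n i \<le> real (card D) * (d i powr sdim + \<eta> i)" .
  qed simp
  also have "\<dots> = 4 * real (card D) * ((\<Sum>i\<in>F. d i powr sdim) + (\<Sum>i\<in>F. \<eta> i))"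
    by (simp add: sum_distrib_left sum.distrib[symmetric] mult.assoc)
  also have "\<dots> \<le> 4 * real (card D) * (\<kappa> + \<kappa>)"
    using part[OF F(1)] \<eta>_sum[OF F(1)] by (intro mult_left_mono) auto
  also have "\<dots> = 1 / 2" using card_D by (simp add: \<kappa>_def)
  finally show False by simp
qed

lemma hausdorff_dim_K: "hausdorff_dim K = ereal sdim"
proof (rule antisym)
  show "hausdorff_dim K \<le> ereal sdim"
  proof (rule ereal_le_epsilon2)
    fix e :: real assume "0 < e"
    then show "hausdorff_dim K \<le> ereal sdim + ereal e"
      unfolding hausdorff_dim_def using hausdorff_measure_K_eq_0[of "sdim + e"] sdim_pos
      by (intro INF_lower2[of "sdim + e"]) auto
  qed
  show "ereal sdim \<le> hausdorff_dim K"
    unfolding hausdorff_dim_def using hausdorff_measure_K_neq_0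
    by (intro INF_greatest) (auto intro: leI)
qed

subsection \<open>Affine copies containing the set\<close>

definition copy :: "real \<Rightarrow> real \<Rightarrow> real set" where
  "copy \<mu> t = (\<lambda>x. \<mu> * x + t) ` K"

lemma copyI: "k \<in> K \<Longrightarrow> \<mu> * k + t \<in> copy \<mu> t"
  by (auto simp: copy_def)

lemma closed_copy: "closed (copy \<mu> t)"
  unfolding copy_def
  by (intro compact_imp_closed compact_continuous_image K_compact continuous_intros)

text \<open>Baire's theorem for finite covers, by induction on their size: if the last set misses a
  point of \<open>K\<close>, it misses a cylinder around that point, and zooming this cylinder up to
  \<open>K\<close> leaves one set fewer.\<close>

lemma closed_cover_contains_cyl:
  fixes C :: "nat \<Rightarrow> real set"
  assumes "K \<subseteq> (\<Union>i<M. C i)" "\<And>i. i < M \<Longrightarrow> closed (C i)"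
  shows "\<exists>i<M. \<exists>l. \<exists>p\<in>prefixes l. cyl l p \<subseteq> C i"
  using assms
proof (induction M arbitrary: C)
  case 0
  then show ?case using K_nonempty by simp
next
  case (Suc M)
  show ?case
  proof (cases "K \<subseteq> C M")
    case True
    then have "cyl 0 0 \<subseteq> C M" by (simp add: cyl_def)
    then show ?thesis by (intro exI[of _ M] exI[of _ 0] conjI bexI[of _ 0]) simp_all
  next
    case False
    then obtain x where x: "x \<in> K" "x \<in> - C M" by blast
    have "open (- C M)" using Suc.prems(2)[of M] by blast
    then obtain e where e: "0 < e" "\<And>y. dist y x < e \<Longrightarrow> y \<in> - C M"
      using x(2) unfolding open_dist by blast
    have "\<forall>\<^sub>F n in sequentially. 1 / B ^ n < e"
      using tendsto_inverse_B_power e(1) by (rule order_tendstoD)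
    then obtain n where n: "1 / B ^ n < e" by (auto simp: eventually_sequentially)
    obtain p where p: "p \<in> prefixes n" "x \<in> cyl n p" using x(1) K_eq_UN_cyl by blast
    have avoid: "y \<notin> C M" if "y \<in> cyl n p" for y
    proof -
      have "dist y x < e" using cyl_diameter[OF that p(2)] n by (simp add: dist_real_def)
      then show ?thesis using e(2) by blast
    qed
    define C' where "C' i = (\<lambda>y. (y + of_int p) / B ^ n) -` C i" for i
    have "K \<subseteq> (\<Union>i<M. C' i)"
    proof
      fix y assume "y \<in> K"
      then have y: "(y + of_int p) / B ^ n \<in> cyl n p" by (rule cylI)
      then have "(y + of_int p) / B ^ n \<in> (\<Union>i<Suc M. C i)"
        using cyl_subset_K[OF p(1)] Suc.prems(1) by blast
      then show "y \<in> (\<Union>i<M. C' i)" using avoid[OF y] by (auto simp: C'_def less_Suc_eq)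
    qed
    moreover have "closed (C' i)" if "i < M" for i
      unfolding C'_def using Suc.prems(2) that B_pos
      by (intro closed_vimage continuous_intros) auto
    ultimately obtain i l q where i: "i < M" "q \<in> prefixes l" "cyl l q \<subseteq> C' i"
      using Suc.IH[of C'] by blast
    have "cyl (n + l) (int b ^ l * p + q) \<subseteq> C i"
    proof
      fix y assume "y \<in> cyl (n + l) (int b ^ l * p + q)"
      then have "B ^ n * y - of_int p \<in> C' i" using i(3) by (auto simp: cyl_add)
      then show "y \<in> C i" using B_pos by (simp add: C'_def)
    qed
    moreover have "int b ^ l * p + q \<in> prefixes (n + l)"
      using p(1) i(2) unfolding prefixes_add by blast
    ultimately show ?thesis using i(1) by (meson less_SucI)
  qed
qed

text \<open>Bounds the number of pieces \<open>\<mu> * (K + r) + a\<close> visible in [0, 1]: such a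
  \<open>K + r\<close> meets an interval of length \<open>1 / \<bar>\<mu>\<bar>\<close>.\<close>

definition num_copies :: "real \<Rightarrow> nat" where
  "num_copies \<mu> = nat \<lceil>1 / \<bar>\<mu>\<bar> + 2\<rceil>"

text \<open>Zooming into the cylinder below which \<open>X\<close> is full splits the copy into
  pieces \<open>\<mu> * (K + r) + a\<close>, and those meeting [0, 1] already hit every cylinder of
  level \<open>m\<close>. Their number and offsets are bounded independently of \<open>m\<close>,
  which prepares the limit in \<open>m\<close>.\<close>

lemma full_copy_finite_approx:
  assumes "\<mu> \<noteq> 0" "X \<subseteq> copy \<mu> t" "full X m"
  shows "\<exists>\<tau>. (\<forall>i < num_copies \<mu>. \<bar>\<tau> i\<bar> \<le> 1 + \<bar>\<mu>\<bar>)
    \<and> (\<forall>q\<in>prefixes m. \<exists>i < num_copies \<mu>. copy \<mu> (\<tau> i) \<inter> cyl m q \<noteq> {})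
    \<and> (copy \<mu> t \<subseteq> K \<longrightarrow> (\<forall>i < num_copies \<mu>. copy \<mu> (\<tau> i) \<inter> {0<..<1} \<subseteq> K))"
proof -
  obtain n p where p: "p \<in> prefixes n"
    and full: "\<And>q. q \<in> prefixes m \<Longrightarrow> X \<inter> cyl (n + m) (int b ^ m * p + q) \<noteq> {}"
    using assms(3) unfolding full_def by blast
  define a where "a = B ^ n * t - of_int p"
  define J where "J = {r \<in> prefixes n. \<exists>k\<in>K. 0 \<le> \<mu> * (k + of_int r) + a \<and> \<mu> * (k + of_int r) + a \<le> 1}"
  have zoom: "B ^ n * (\<mu> * ((k + of_int r) / B ^ n) + t) - of_int p = \<mu> * (k + of_int r) + a" for k r
  proof -
    have "B ^ n * (\<mu> * ((k + of_int r) / B ^ n) + t) = \<mu> * (k + of_int r) + B ^ n * t"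
      using B_pos by (simp add: distrib_left[of "B ^ n"])
    then show ?thesis by (simp add: a_def)
  qed
  have card_J: "card J \<le> num_copies \<mu>"
  proof -
    obtain y where y: "\<And>k. 0 \<le> \<mu> * k + a \<Longrightarrow> \<mu> * k + a \<le> 1 \<Longrightarrow> k \<in> {y..y + 1 / \<bar>\<mu>\<bar>}"
      using affine_vimage_interval[OF assms(1), of 0 a 1] by auto
    have "real (card J) \<le> 1 / \<bar>\<mu>\<bar> + 2"
    proof (rule card_int_near_interval(2))
      fix r assume "r \<in> J"
      then obtain k where "k \<in> K" "k + of_int r \<in> {y..y + 1 / \<bar>\<mu>\<bar>}" using y by (auto simp: J_def)
      then show "\<exists>z\<in>{y..y + 1 / \<bar>\<mu>\<bar>}. z - of_int r \<in> K"
        by (intro bexI[of _ "k + of_int r"]) simp_all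
    qed simp
    then show ?thesis unfolding num_copies_def by linarith
  qed
  have J_hits: "\<exists>r\<in>J. \<exists>k\<in>K. \<mu> * (k + of_int r) + a \<in> cyl m q" if q: "q \<in> prefixes m" for q
  proof -
    obtain x where x: "x \<in> X" "x \<in> cyl (n + m) (int b ^ m * p + q)" using full[OF q] by blast
    then obtain x' where x': "x' \<in> K" "x = \<mu> * x' + t" using assms(2) by (auto simp: copy_def)
    then obtain r where r: "r \<in> prefixes n" "x' \<in> cyl n r" using K_eq_UN_cyl by blast
    then obtain k where k: "k \<in> K" "x' = (k + of_int r) / B ^ n" by (auto simp: cyl_iff)
    have z: "\<mu> * (k + of_int r) + a \<in> cyl m q"
      using x(2) unfolding cyl_add x'(2) k(2) zoom .
    then have "0 \<le> \<mu> * (k + of_int r) + a \<and> \<mu> * (k + of_int r) + a \<le> 1"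
      using cyl_subset_K[OF q] K_bounds by blast
    then show ?thesis using r(1) k(1) z unfolding J_def by blast
  qed
  have "prefixes m \<noteq> {}" using card_prefixes[of m] card_D by fastforce
  then have "J \<noteq> {}" using J_hits by blast
  have "finite J" using finite_prefixes by (simp add: J_def)
  obtain N and h :: "nat \<Rightarrow> int" where "J = h ` {i. i < N}" "inj_on h {i. i < N}"
    using finite_imp_nat_seg_image_inj_on[OF \<open>finite J\<close>] by blast
  then have h: "J = h ` {i. i < N}" and N: "N \<le> num_copies \<mu>"
    using card_J by (simp_all add: card_image)
  have "0 < N" using h \<open>J \<noteq> {}\<close> by auto
  \<comment> \<open>Repeats \<open>h 0\<close> so that the number of translates is the same for
    every \<open>m\<close>.\<close>
  define g where "g i = (if i < N then h i else h 0)" for i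
  have gJ: "g i \<in> J" for i using h \<open>0 < N\<close> by (auto simp: g_def)
  define \<tau> where "\<tau> i = \<mu> * of_int (g i) + a" for i
  have \<tau>_eq: "\<mu> * k + \<tau> i = \<mu> * (k + of_int (g i)) + a" for k i
    by (simp add: \<tau>_def distrib_left)
  have bnd: "\<bar>\<tau> i\<bar> \<le> 1 + \<bar>\<mu>\<bar>" for i
  proof -
    obtain k where k: "k \<in> K" "0 \<le> \<mu> * k + \<tau> i" "\<mu> * k + \<tau> i \<le> 1"
      using gJ[of i] unfolding J_def \<tau>_eq by blast
    have "\<bar>\<mu> * k\<bar> \<le> \<bar>\<mu>\<bar>" using K_bounds[OF k(1)] by (simp add: abs_mult mult_left_le)
    then show ?thesis using k(2,3) by linarith
  qed
  have cov: "\<exists>i < num_copies \<mu>. copy \<mu> (\<tau> i) \<inter> cyl m q \<noteq> {}" if q: "q \<in> prefixes m" for q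
  proof -
    obtain r k where r: "r \<in> J" "k \<in> K" "\<mu> * (k + of_int r) + a \<in> cyl m q"
      using J_hits[OF q] by blast
    then obtain i where i: "i < N" "r = h i" using h by blast
    then have "\<mu> * k + \<tau> i \<in> cyl m q" using r(3) by (simp add: \<tau>_eq g_def)
    then show ?thesis using i(1) N r(2) by (intro exI[of _ i]) (auto simp: copy_def)
  qed
  \<comment> \<open>Zoomed out, the point lies in \<open>K\<close>, hence in some cylinder
    \<open>r\<close>; as it lies strictly inside the unit interval at \<open>p\<close>, this forces
    \<open>r = p\<close>.\<close>
  have inK: "copy \<mu> (\<tau> i) \<inter> {0<..<1} \<subseteq> K" if "copy \<mu> t \<subseteq> K" for i
  proof
    fix y assume y: "y \<in> copy \<mu> (\<tau> i) \<inter> {0<..<1}"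
    then obtain k where k: "k \<in> K" "y = \<mu> * k + \<tau> i" by (auto simp: copy_def)
    have "g i \<in> prefixes n" using gJ by (auto simp: J_def)
    from cyl_subset_K[OF this] have "(k + of_int (g i)) / B ^ n \<in> K" using cylI[OF k(1)] by blast
    then have "\<mu> * ((k + of_int (g i)) / B ^ n) + t \<in> K" using that by (auto simp: copy_def)
    then obtain r where "\<mu> * ((k + of_int (g i)) / B ^ n) + t \<in> cyl n r" using K_eq_UN_cyl by blast
    then have r: "B ^ n * (\<mu> * ((k + of_int (g i)) / B ^ n) + t) - of_int r \<in> K"
      by (simp only: cyl_def mem_Collect_eq)
    have eq: "B ^ n * (\<mu> * ((k + of_int (g i)) / B ^ n) + t) = y + of_int p"
      using zoom[of k "g i"] by (simp add: k(2) \<tau>_eq)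
    have "y + of_int p - of_int r \<in> K" using r unfolding eq .
    moreover from this have "r = p" using y by (intro unit_interval_int_eq) auto
    ultimately show "y \<in> K" by simp
  qed
  show ?thesis using bnd cov inK by blast
qed

section \<open>Limits of the zoomed copies\<close>

lemma common_convergent_subsequence:
  fixes f :: "nat \<Rightarrow> nat \<Rightarrow> real"
  assumes "\<And>m i. i < M \<Longrightarrow> \<bar>f m i\<bar> \<le> R"
  shows "\<exists>T \<sigma>. strict_mono \<sigma> \<and> (\<forall>i<M. (\<lambda>m. f (\<sigma> m) i) \<longlonglongrightarrow> T i)"
  using assms
proof (induction M)
  case 0
  then show ?case using strict_mono_id by blast
next
  case (Suc M)
  then obtain T and \<sigma> :: "nat \<Rightarrow> nat" where IH: "strict_mono \<sigma>" "\<And>i. i < M \<Longrightarrow> (\<lambda>m. f (\<sigma> m) i) \<longlonglongrightarrow> T i"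
    by (meson less_SucI)
  have "bounded (range (\<lambda>m. f (\<sigma> m) M))"
    using Suc.prems by (intro boundedI[of _ R]) auto
  then obtain l r where r: "strict_mono r" "((\<lambda>m. f (\<sigma> m) M) \<circ> r) \<longlonglongrightarrow> l"
    using bounded_imp_convergent_subsequence by blast
  have "(\<lambda>m. f ((\<sigma> \<circ> r) m) i) \<longlonglongrightarrow> (T(M := l)) i" if "i < Suc M" for i
  proof (cases "i = M")
    case True
    then show ?thesis using r(2) by (simp add: comp_def)
  next
    case False
    then have "i < M" using that by simp
    from LIMSEQ_subseq_LIMSEQ[OF IH(2)[OF this] r(1)] False show ?thesis by (simp add: comp_def)
  qed
  then show ?case using strict_mono_o[OF IH(1) r(1)] by blast
qed

text \<open>Offsets converge along a subsequence of \<open>m\<close>. A point of \<open>K\<close>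
  missed by the limit copies would have a neighbourhood missed by them, yet a small cylinder around
  it is hit by a nearby translate. Inclusion in \<open>K\<close> survives because (0, 1) is open and
  \<open>K\<close> is closed.\<close>

lemma full_copy_limit:
  assumes "\<mu> \<noteq> 0" "X \<subseteq> copy \<mu> t" "\<And>m. full X m"
  shows "\<exists>T. K \<subseteq> (\<Union>i<num_copies \<mu>. copy \<mu> (T i))
    \<and> (copy \<mu> t \<subseteq> K \<longrightarrow> (\<forall>i < num_copies \<mu>. copy \<mu> (T i) \<inter> {0<..<1} \<subseteq> K))"
proof -
  define M where "M = num_copies \<mu>"
  have "\<forall>m. \<exists>\<tau>. (\<forall>i < M. \<bar>\<tau> i\<bar> \<le> 1 + \<bar>\<mu>\<bar>)
    \<and> (\<forall>q\<in>prefixes m. \<exists>i < M. copy \<mu> (\<tau> i) \<inter> cyl m q \<noteq> {})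
    \<and> (copy \<mu> t \<subseteq> K \<longrightarrow> (\<forall>i < M. copy \<mu> (\<tau> i) \<inter> {0<..<1} \<subseteq> K))"
    unfolding M_def using full_copy_finite_approx[OF assms(1,2) assms(3)] by blast
  then obtain \<tau> where \<tau>: "\<And>m i. i < M \<Longrightarrow> \<bar>\<tau> m i\<bar> \<le> 1 + \<bar>\<mu>\<bar>"
    "\<And>m q. q \<in> prefixes m \<Longrightarrow> \<exists>i < M. copy \<mu> (\<tau> m i) \<inter> cyl m q \<noteq> {}"
    "\<And>m i. copy \<mu> t \<subseteq> K \<Longrightarrow> i < M \<Longrightarrow> copy \<mu> (\<tau> m i) \<inter> {0<..<1} \<subseteq> K"
    by metis
  obtain T and \<sigma> :: "nat \<Rightarrow> nat" where \<sigma>: "strict_mono \<sigma>" and T: "\<And>i. i < M \<Longrightarrow> (\<lambda>m. \<tau> (\<sigma> m) i) \<longlonglongrightarrow> T i"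
    using common_convergent_subsequence[of M \<tau>, OF \<tau>(1)] by blast
  have "K \<subseteq> (\<Union>i<M. copy \<mu> (T i))"
  proof (rule ccontr)
    define S where "S = (\<Union>i<M. copy \<mu> (T i))"
    assume "\<not> K \<subseteq> (\<Union>i<M. copy \<mu> (T i))"
    then obtain x where x: "x \<in> K" "x \<in> - S" unfolding S_def by blast
    have "open (- S)" unfolding S_def using closed_copy by (intro open_Compl closed_UN) auto
    then obtain e where e: "0 < e" "\<And>y. dist y x < e \<Longrightarrow> y \<in> - S"
      using x(2) unfolding open_dist by blast
    have "(\<lambda>m. 1 / B ^ \<sigma> m) \<longlonglongrightarrow> 0"
      using LIMSEQ_subseq_LIMSEQ[OF tendsto_inverse_B_power \<sigma>] by (simp add: comp_def)
    then have "\<forall>\<^sub>F m in sequentially. 1 / B ^ \<sigma> m < e / 2"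
      using e(1) by (intro order_tendstoD) auto
    moreover have "\<forall>\<^sub>F m in sequentially. \<forall>i\<in>{..<M}. dist (\<tau> (\<sigma> m) i) (T i) < e / 2"
      using T e(1) by (intro eventually_ball_finite ballI tendstoD) auto
    ultimately have "\<forall>\<^sub>F m in sequentially. 1 / B ^ \<sigma> m < e / 2 \<and> (\<forall>i\<in>{..<M}. dist (\<tau> (\<sigma> m) i) (T i) < e / 2)"
      by (rule eventually_conj)
    then obtain m where m: "1 / B ^ \<sigma> m < e / 2" "\<And>i. i < M \<Longrightarrow> dist (\<tau> (\<sigma> m) i) (T i) < e / 2"
      by (auto simp: eventually_sequentially)
    obtain q where q: "q \<in> prefixes (\<sigma> m)" "x \<in> cyl (\<sigma> m) q" using x(1) K_eq_UN_cyl by blast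
    obtain i k where ik: "i < M" "k \<in> K" "\<mu> * k + \<tau> (\<sigma> m) i \<in> cyl (\<sigma> m) q"
      using \<tau>(2)[OF q(1)] by (auto simp: copy_def)
    have "\<bar>x - (\<mu> * k + \<tau> (\<sigma> m) i)\<bar> < e / 2" using cyl_diameter[OF q(2) ik(3)] m(1) by linarith
    then have "dist (\<mu> * k + T i) x < e" using m(2)[OF ik(1)] unfolding dist_real_def by linarith
    then have "\<mu> * k + T i \<in> - S" by (rule e(2))
    then show False using ik(1,2) by (auto simp: S_def copy_def)
  qed
  moreover have "copy \<mu> (T i) \<inter> {0<..<1} \<subseteq> K" if "copy \<mu> t \<subseteq> K" "i < M" for i
  proof
    fix y assume y: "y \<in> copy \<mu> (T i) \<inter> {0<..<1}"
    then obtain k where k: "k \<in> K" "y = \<mu> * k + T i" by (auto simp: copy_def)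
    have lim: "(\<lambda>m. \<mu> * k + \<tau> (\<sigma> m) i) \<longlonglongrightarrow> y"
      unfolding k(2) by (intro tendsto_intros T that)
    then have "\<forall>\<^sub>F m in sequentially. \<mu> * k + \<tau> (\<sigma> m) i \<in> {0<..<1}"
      using y by (intro topological_tendstoD) auto
    then have "\<forall>\<^sub>F m in sequentially. \<mu> * k + \<tau> (\<sigma> m) i \<in> K"
    proof (rule eventually_mono)
      fix m assume "\<mu> * k + \<tau> (\<sigma> m) i \<in> {0<..<1}"
      then show "\<mu> * k + \<tau> (\<sigma> m) i \<in> K" using \<tau>(3)[OF that, of "\<sigma> m"] k(1) by (auto simp: copy_def)
    qed
    then show "y \<in> K" using K_closed lim by (intro Lim_in_closed_set[of K _ sequentially]) auto
  qed
  ultimately show ?thesis unfolding M_def by blast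
qed

text \<open>One of the finitely many limit copies contains a cylinder; magnifying this cylinder to
  \<open>K\<close> multiplies the ratio by \<open>B ^ l\<close>.\<close>

lemma full_copy_covers_K:
  assumes "\<mu> \<noteq> 0" "X \<subseteq> copy \<mu> t" "\<And>m. full X m"
  shows "\<exists>l t'. K \<subseteq> copy (\<mu> * B ^ l) t' \<and> (copy \<mu> t \<subseteq> K \<longrightarrow> copy (\<mu> * B ^ l) t' \<inter> {0<..<1} \<subseteq> K)"
proof -
  obtain T where T: "K \<subseteq> (\<Union>i<num_copies \<mu>. copy \<mu> (T i))"
    "copy \<mu> t \<subseteq> K \<Longrightarrow> \<forall>i < num_copies \<mu>. copy \<mu> (T i) \<inter> {0<..<1} \<subseteq> K"
    using full_copy_limit[OF assms] by blast
  obtain i l p where i: "i < num_copies \<mu>" and p: "p \<in> prefixes l" "cyl l p \<subseteq> copy \<mu> (T i)"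
    using closed_cover_contains_cyl[OF T(1) closed_copy] by blast
  define t' where "t' = B ^ l * T i - of_int p"
  have zoom: "B ^ l * (\<mu> * k + T i) = \<mu> * B ^ l * k + t' + of_int p" for k
    by (simp add: t'_def algebra_simps)
  have "K \<subseteq> copy (\<mu> * B ^ l) t'"
  proof
    fix x assume "x \<in> K"
    then have "(x + of_int p) / B ^ l \<in> copy \<mu> (T i)" using cylI p(2) by blast
    then obtain k where k: "k \<in> K" "(x + of_int p) / B ^ l = \<mu> * k + T i" by (auto simp: copy_def)
    have "x + of_int p = B ^ l * ((x + of_int p) / B ^ l)" using B_pos by simp
    also have "\<dots> = \<mu> * B ^ l * k + t' + of_int p" unfolding k(2) zoom ..
    finally have "x = \<mu> * B ^ l * k + t'" by simp
    then show "x \<in> copy (\<mu> * B ^ l) t'" using k(1) by (auto simp: copy_def)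
  qed
  moreover have "copy (\<mu> * B ^ l) t' \<inter> {0<..<1} \<subseteq> K" if "copy \<mu> t \<subseteq> K"
  proof
    fix y assume y: "y \<in> copy (\<mu> * B ^ l) t' \<inter> {0<..<1}"
    then obtain k where k: "k \<in> K" "y = \<mu> * B ^ l * k + t'" by (auto simp: copy_def)
    define z where "z = \<mu> * k + T i"
    have z: "B ^ l * z = y + of_int p" by (simp add: z_def zoom k(2))
    \<comment> \<open>The bounds on \<open>p\<close> keep the demagnified point inside (0, 1), where
      the limit copy is known to lie in \<open>K\<close>.\<close>
    have "0 \<le> p" "p + 1 \<le> int b ^ l" using prefixes_bounds[OF p(1)] by auto
    then have "0 \<le> (of_int p :: real)" "of_int (p + 1) \<le> (of_int (int b ^ l) :: real)"
      by (simp_all only: of_int_le_iff of_int_0_le_iff)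
    then have "0 < B ^ l * z" "B ^ l * z < B ^ l * 1" using y by (simp_all add: z)
    then have "0 < z" "z < 1" using B_pos by (simp_all add: zero_less_mult_iff)
    then have "z \<in> copy \<mu> (T i) \<inter> {0<..<1}" using copyI[OF k(1)] by (simp add: z_def)
    then have "z \<in> K" using T(2)[OF that] i by blast
    then obtain r where "z \<in> cyl l r" using K_eq_UN_cyl by blast
    then have "B ^ l * z - of_int r \<in> K" by (simp add: cyl_def)
    then have r: "y + of_int p - of_int r \<in> K" by (simp add: z)
    then have "r = p" using y by (intro unit_interval_int_eq) auto
    then show "y \<in> K" using r by simp
  qed
  ultimately show ?thesis by blast
qed

text \<open>An affine copy of \<open>K\<close> needs as many intervals as \<open>K\<close> up to a
  constant factor, so it cannot lose the factor \<open>(M - 1) / M\<close> every \<open>m\<close>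
  generations.\<close>

lemma self_copy_full:
  assumes "\<mu> \<noteq> 0" "copy \<mu> t \<subseteq> K"
  shows "full (copy \<mu> t) m"
proof (rule ccontr)
  assume nf: "\<not> full (copy \<mu> t) m"
  define X where "X = copy \<mu> t"
  \<comment> \<open>The constant \<open>c + 2\<close> of \<open>weighted_cover_bound\<close> for the
    pulled-back lengths \<open>1 / \<bar>\<mu>\<bar> / B ^ n\<close>.\<close>
  define R where "R = 1 / \<bar>\<mu>\<bar> + 2"
  have R: "0 < R" by (simp add: R_def add_nonneg_pos)
  define M where "M = card D ^ m"
  have M: "0 < M" using card_D by (simp add: M_def)
  have main: "1 \<le> R * (real (M - 1) / real M) ^ k" for k
  proof -
    define n where "n = k * m"
    have "\<exists>y. \<forall>z. of_int p / B ^ n \<le> \<mu> * z + t \<longrightarrow> \<mu> * z + t \<le> of_int p / B ^ n + 1 / B ^ n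
        \<longrightarrow> z \<in> {y..y + 1 / \<bar>\<mu>\<bar> / B ^ n}" for p
      using affine_vimage_interval[OF assms(1), of "of_int p / B ^ n" t "1 / B ^ n"]
      by (simp add: mult.commute)
    then obtain g where g: "\<And>p z. of_int p / B ^ n \<le> \<mu> * z + t \<Longrightarrow> \<mu> * z + t \<le> of_int p / B ^ n + 1 / B ^ n
        \<Longrightarrow> z \<in> {g p..g p + 1 / \<bar>\<mu>\<bar> / B ^ n}" for p :: int
      by metis
    have "K \<subseteq> (\<Union>p\<in>hit X n. {g p..g p + 1 / \<bar>\<mu>\<bar> / B ^ n})"
    proof
      fix z assume "z \<in> K"
      then have zX: "\<mu> * z + t \<in> X" by (auto simp: X_def copy_def)
      then obtain p where p: "p \<in> prefixes n" "\<mu> * z + t \<in> cyl n p"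
        using assms(2) K_eq_UN_cyl X_def by blast
      then have "p \<in> hit X n" using zX by (auto simp: hit_def)
      moreover have "z \<in> {g p..g p + 1 / \<bar>\<mu>\<bar> / B ^ n}"
        using cyl_subset_interval[of n "1 / B ^ n" p] p(2) by (intro g) auto
      ultimately show "z \<in> (\<Union>p\<in>hit X n. {g p..g p + 1 / \<bar>\<mu>\<bar> / B ^ n})" by blast
    qed
    from weighted_cover_bound[OF finite_hit _ this]
    have "1 \<le> real (card (hit X n)) * (R / real (card D) ^ n)" by (simp add: R_def)
    also have "\<dots> \<le> real ((M - 1) ^ k) * (R / real (card D) ^ n)"
      using card_hit_le[OF nf, of k] R by (intro mult_right_mono) (simp_all add: X_def n_def M_def)
    also have "\<dots> = R * (real (M - 1) / real M) ^ k"
      by (simp add: n_def M_def power_divide power_mult mult.commute[of k m])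
    finally show ?thesis .
  qed
  have "real (M - 1) / real M < 1" using M by (simp add: field_simps)
  then have "(\<lambda>k. R * (real (M - 1) / real M) ^ k) \<longlonglongrightarrow> R * 0"
    by (intro tendsto_mult_left LIMSEQ_realpow_zero) auto
  then have "\<forall>\<^sub>F k in sequentially. R * (real (M - 1) / real M) ^ k < 1"
    by (rule order_tendstoD) simp
  then show False using main by (auto simp: eventually_sequentially not_less[symmetric])
qed

text \<open>A point lies in at most two of the translates \<open>K + q\<close>, whereas there are at
  least four prefixes of length 2. This settles the degenerate ratio 0.\<close>

lemma singleton_not_full: "\<not> full {x} 2"
proof
  assume "full {x} 2"
  then obtain n p where full: "\<And>q. q \<in> prefixes 2 \<Longrightarrow> {x} \<inter> cyl (n + 2) (int b ^ 2 * p + q) \<noteq> {}"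
    unfolding full_def by blast
  define y where "y = B ^ 2 * (B ^ n * x - of_int p)"
  have "y - of_int q \<in> K" if "q \<in> prefixes 2" for q
  proof -
    have "x \<in> cyl (n + 2) (int b ^ 2 * p + q)" using full[OF that] by blast
    then show ?thesis unfolding cyl_add by (simp only: cyl_def mem_Collect_eq y_def)
  qed
  then have "real (card (prefixes 2)) \<le> 0 + 2"
    by (intro card_int_near_interval(2)[of 0 "prefixes 2" y]) auto
  moreover have "2 ^ 2 \<le> card (prefixes 2)"
    unfolding card_prefixes using card_D by (intro power_mono) auto
  ultimately show False by simp
qed

subsection \<open>Gap lengths\<close>

definition gap :: "real \<Rightarrow> real \<Rightarrow> bool" where
  "gap u v \<longleftrightarrow> u \<in> K \<and> v \<in> K \<and> u < v \<and> {u<..<v} \<inter> K = {}"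

lemma D_two: obtains d e where "d \<in> D" "e \<in> D" "d < e"
proof -
  have "\<not> card D \<le> Suc 0" using card_D by simp
  then obtain x y where "x \<in> D" "y \<in> D" "x \<noteq> y" using finite_D card_le_Suc0_iff_eq by blast
  then show thesis using that by (cases "x < y") (auto simp: neq_iff)
qed

lemma K_two: obtains x y where "x \<in> K" "y \<in> K" "x < y"
proof -
  obtain d e where de: "d \<in> D" "e \<in> D" "d < e" by (rule D_two)
  obtain k where k: "k \<in> K" using K_nonempty by blast
  have "(k + real d) / B < (k + real e) / B" using de(3) B_pos by (intro divide_strict_right_mono) auto
  then show thesis using that K_prepend_digit[OF k] de by blast
qed

text \<open>A digit outside \<open>D\<close> leaves a hole in every cell of the
  base-\<open>b\<close> grid, and a long enough magnification of the interval contains a whole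
  cell.\<close>

lemma K_no_interval:
  assumes "card D < b" "x < y"
  shows "\<not> {x..y} \<subseteq> K"
proof
  assume sub: "{x..y} \<subseteq> K"
  have "\<not> {..<b} \<subseteq> D" using assms(1) card_mono[OF finite_D, of "{..<b}"] by auto
  then obtain d0 where d0: "d0 < b" "d0 \<notin> D" by auto
  obtain n where n: "2 / (y - x) < B ^ n" using B_power_unbounded by blast
  then have n2: "2 < B ^ n * y - B ^ n * x" using assms(2) by (simp add: pos_divide_less_eq right_diff_distrib)
  define p where "p = \<lceil>B ^ n * x\<rceil>"
  \<comment> \<open>The point with integer part \<open>p\<close>, next digit \<open>d0\<close> and
    remainder 1/2, which makes that digit unambiguous.\<close>
  define z where "z = of_int p + (real d0 + 1 / 2) / B"
  have "0 \<le> (real d0 + 1 / 2) / B" "(real d0 + 1 / 2) / B \<le> 1" using d0(1) B_pos by simp_all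
  moreover have "B ^ n * x \<le> of_int p" "of_int p \<le> B ^ n * x + 1" unfolding p_def by linarith+
  ultimately have "B ^ n * x \<le> z" "z \<le> B ^ n * y" using n2 unfolding z_def by linarith+
  then have "z / B ^ n \<in> {x..y}" using B_pos by (simp add: pos_le_divide_eq pos_divide_le_eq mult.commute)
  then have "z / B ^ n \<in> K" using sub by blast
  then obtain r where r: "r \<in> prefixes (Suc n)" "z / B ^ n \<in> cyl (Suc n) r" using K_eq_UN_cyl by blast
  have "B ^ Suc n * (z / B ^ n) = B * z" using B_pos by simp
  also have "\<dots> = 1 / 2 + of_int (int b * p + int d0)"
  proof -
    have "B * ((real d0 + 1 / 2) / B) = real d0 + 1 / 2" using B_pos by simp
    then show ?thesis by (simp add: z_def distrib_left[of B "of_int p"])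
  qed
  finally have "1 / 2 + of_int (int b * p + int d0) - of_int r \<in> K"
    using r(2) by (simp only: cyl_def mem_Collect_eq)
  then have "r = int b * p + int d0" by (rule unit_interval_int_eq) auto
  moreover obtain q d where "d \<in> D" "r = int b * q + int d" using r(1) by auto
  ultimately have eq: "(int b * p + int d0) mod int b = (int b * q + int d) mod int b" by simp
  have "(int b * p + int d0) mod int b = int d0" "(int b * q + int d) mod int b = int d"
    using d0(1) D_less[OF \<open>d \<in> D\<close>] by simp_all
  then show False using eq d0(2) \<open>d \<in> D\<close> by simp
qed

lemma gap_exists:
  assumes "card D < b"
  obtains u v where "gap u v"
proof -
  obtain x y where xy: "x \<in> K" "y \<in> K" "x < y" by (rule K_two)
  obtain z where "z \<in> {x..y}" "z \<notin> K" using K_no_interval[OF assms xy(3)] by blast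
  then have z: "x \<le> z" "z \<le> y" "z \<notin> K" by auto
  have "compact (K \<inter> {x..z})" "compact (K \<inter> {z..y})"
    using K_compact by (auto intro: compact_Int_closed)
  moreover have "K \<inter> {x..z} \<noteq> {}" "K \<inter> {z..y} \<noteq> {}" using xy z by auto
  ultimately have "\<exists>u\<in>K \<inter> {x..z}. \<forall>t\<in>K \<inter> {x..z}. t \<le> u" "\<exists>v\<in>K \<inter> {z..y}. \<forall>t\<in>K \<inter> {z..y}. v \<le> t"
    using compact_attains_sup[of "K \<inter> {x..z}"] compact_attains_inf[of "K \<inter> {z..y}"] by blast+
  then obtain u v where u: "u \<in> K \<inter> {x..z}" "\<And>t. t \<in> K \<inter> {x..z} \<Longrightarrow> t \<le> u"
    and v: "v \<in> K \<inter> {z..y}" "\<And>t. t \<in> K \<inter> {z..y} \<Longrightarrow> v \<le> t"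
    by blast
  have "u < z" "z < v" using u(1) v(1) z(3) by (auto simp: order_less_le)
  moreover have "{u<..<v} \<inter> K = {}"
  proof (rule ccontr)
    assume "{u<..<v} \<inter> K \<noteq> {}"
    then obtain w where w: "u < w" "w < v" "w \<in> K" by auto
    show False
    proof (cases "w \<le> z")
      case True
      then have "w \<in> K \<inter> {x..z}" using w u(1) by auto
      then show False using u(2)[of w] w by linarith
    next
      case False
      then have "w \<in> K \<inter> {z..y}" using w v(1) by auto
      then show False using v(2)[of w] w by linarith
    qed
  qed
  ultimately show thesis using that[of u v] u(1) v(1) by (simp add: gap_def)
qed

text \<open>A small cylinder of \<open>K\<close> is carried by the embedding into (0, 1), where
  \<open>K\<close> and the copy agree; the gap inside that cylinder therefore becomes a gap of
  \<open>K\<close>, shrunk by \<open>B ^ n\<close>.\<close>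

lemma gap_scale_by_embedding:
  assumes "\<mu> \<noteq> 0" and eq: "K \<inter> {0<..<1} = copy \<mu> t \<inter> {0<..<1}" and "gap u v"
  shows "\<exists>n u' v'. gap u' v' \<and> v' - u' = \<bar>\<mu>\<bar> * (v - u) / B ^ n"
proof -
  have uv: "u \<in> K" "v \<in> K" "u < v" "\<And>w. w \<in> K \<Longrightarrow> u < w \<Longrightarrow> w < v \<Longrightarrow> False"
    using assms(3) by (auto simp: gap_def)
  have uv01: "0 \<le> u" "v \<le> 1" using K_bounds uv by auto
  obtain d e where de: "d \<in> D" "e \<in> D" "d < e" by (rule D_two)
  \<comment> \<open>A point of \<open>K\<close> strictly inside (0, 1): positive because
    \<open>e > 0\<close>, below 1 because \<open>u < v \<le> 1\<close>.\<close>
  define y where "y = (u + real e) / B"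
  have "real e + 1 \<le> B" using D_less[OF de(2)] by linarith
  then have y01: "0 < y" "y < 1" using uv uv01 de(3) B_pos by (simp_all add: y_def)
  moreover have "y \<in> K" using K_prepend_digit[OF uv(1) de(2)] by (simp add: y_def)
  ultimately have "y \<in> K \<inter> {0<..<1}" by simp
  then have "y \<in> copy \<mu> t" using eq by blast
  then obtain k where k: "k \<in> K" "y = \<mu> * k + t" by (auto simp: copy_def)
  have "\<forall>\<^sub>F n in sequentially. \<bar>\<mu>\<bar> / B ^ n < min y (1 - y)"
    using tendsto_inverse_B_power y01 by (intro order_tendstoD) auto
  then obtain n where n: "\<bar>\<mu>\<bar> / B ^ n < min y (1 - y)" by (auto simp: eventually_sequentially)
  obtain p where p: "p \<in> prefixes n" "k \<in> cyl n p" using k(1) K_eq_UN_cyl by blast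
  define f where "f z = \<mu> * ((z + of_int p) / B ^ n) + t" for z
  have f_diff: "f z - f z' = \<mu> / B ^ n * (z - z')" for z z'
    by (simp add: f_def diff_divide_distrib add_divide_distrib algebra_simps)
  have f_in: "f z \<in> K" "f z \<in> {0<..<1}" if "z \<in> K" for z
  proof -
    have z: "(z + of_int p) / B ^ n \<in> cyl n p" using that by (rule cylI)
    have "\<bar>(z + of_int p) / B ^ n - k\<bar> \<le> 1 / B ^ n" by (rule cyl_diameter[OF z p(2)])
    then have "\<bar>\<mu>\<bar> * \<bar>(z + of_int p) / B ^ n - k\<bar> \<le> \<bar>\<mu>\<bar> * (1 / B ^ n)" by (intro mult_left_mono) auto
    moreover have "f z - y = \<mu> * ((z + of_int p) / B ^ n - k)" by (simp add: f_def k(2) right_diff_distrib)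
    ultimately have "\<bar>f z - y\<bar> \<le> \<bar>\<mu>\<bar> / B ^ n" by (simp add: abs_mult)
    then show "f z \<in> {0<..<1}" using n by auto
    moreover have "f z \<in> copy \<mu> t"
      unfolding f_def using z cyl_subset_K[OF p(1)] by (intro copyI) blast
    ultimately show "f z \<in> K" using eq by blast
  qed
  have between: False if w: "w \<in> K" "min (f u) (f v) < w" "w < max (f u) (f v)" for w
  proof -
    have w01: "w \<in> {0<..<1}" using f_in(2)[OF uv(1)] f_in(2)[OF uv(2)] w by auto
    then have "w \<in> copy \<mu> t" using w(1) eq by blast
    then obtain k' where k': "k' \<in> K" "w = \<mu> * k' + t" by (auto simp: copy_def)
    define z where "z = B ^ n * k' - of_int p"
    have fz: "w = f z" using B_pos by (simp add: f_def z_def k'(2))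
    \<comment> \<open>The product form of betweenness treats both signs of \<open>\<mu>\<close> at
      once.\<close>
    have sgn: "(f z - f u) * (f v - f z) > 0" using w(2,3) unfolding fz
      by (auto simp: min_def max_def zero_less_mult_iff split: if_splits)
    have "(f z - f u) * (f v - f z) = (\<mu> / B ^ n)\<^sup>2 * ((z - u) * (v - z))"
      unfolding f_diff by (simp add: power2_eq_square)
    then have "0 < (\<mu> / B ^ n)\<^sup>2 * ((z - u) * (v - z))" using sgn by simp
    moreover have "0 < (\<mu> / B ^ n)\<^sup>2" using assms(1) B_pos by simp
    ultimately have "0 < (z - u) * (v - z)" by (rule zero_less_mult_pos)
    then have z: "u < z" "z < v" using uv(3) by (auto simp: zero_less_mult_iff)
    \<comment> \<open>Since \<open>z\<close> lies strictly between 0 and 1, the preimage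
      \<open>k'\<close> can only sit in the cylinder of \<open>p\<close>.\<close>
    obtain r where "k' \<in> cyl n r" using k'(1) K_eq_UN_cyl by blast
    then have r: "z + of_int p - of_int r \<in> K" by (simp add: cyl_def z_def)
    then have "r = p" using z uv01 by (intro unit_interval_int_eq) auto
    then have "z \<in> K" using r by simp
    then show False using uv(4) z by blast
  qed
  have "f v - f u \<noteq> 0" unfolding f_diff using assms(1) uv(3) B_pos by simp
  then have "gap (min (f u) (f v)) (max (f u) (f v))"
    unfolding gap_def using f_in(1)[OF uv(1)] f_in(1)[OF uv(2)] between
    by (auto simp: min_def max_def)
  moreover have "max (f u) (f v) - min (f u) (f v) = \<bar>\<mu>\<bar> * (v - u) / B ^ n"
  proof -
    have "max (f u) (f v) - min (f u) (f v) = \<bar>f v - f u\<bar>" by (simp add: max_def min_def)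
    also have "\<dots> = \<bar>\<mu>\<bar> * (v - u) / B ^ n"
      unfolding f_diff using uv(3) B_pos by (simp add: abs_mult)
    finally show ?thesis .
  qed
  ultimately show ?thesis by blast
qed

text \<open>Splitting off a digit returns \<open>x\<close> itself, so \<open>x\<close> solves
  \<open>B * x - d = x\<close>.\<close>

lemma extreme_point_rational:
  assumes "x \<in> K" and ext: "\<And>d y. d \<in> D \<Longrightarrow> y \<in> K \<Longrightarrow> x = (y + real d) / B \<Longrightarrow> y = x"
  shows "x \<in> \<rat>"
proof -
  obtain d where d: "d \<in> D" "B * x - real d \<in> K" using K_first_digit[OF assms(1)] by blast
  then have "B * x - real d = x" using ext[OF d] B_pos by simp
  then have "x = real d / (B - 1)" using B_gt_1 by (simp add: field_simps)
  then show ?thesis by simp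
qed

text \<open>Magnify by \<open>b\<close> while both endpoints share a first-level piece. Once they
  separate, the gap runs from the maximum of one piece to the minimum of another, so its length
  depends only on two digits and the rational extremes of \<open>K\<close>.\<close>

lemma gap_lengths_finite:
  "\<exists>\<Gamma>. finite \<Gamma> \<and> \<Gamma> \<subseteq> \<rat> \<and> (\<forall>u v. gap u v \<longrightarrow> (\<exists>j::nat. B ^ j * (v - u) \<in> \<Gamma>))"
proof -
  obtain mx where mx: "mx \<in> K" "\<And>x. x \<in> K \<Longrightarrow> x \<le> mx"
    using compact_attains_sup[OF K_compact K_nonempty] by blast
  obtain mn where mn: "mn \<in> K" "\<And>x. x \<in> K \<Longrightarrow> mn \<le> x"
    using compact_attains_inf[OF K_compact K_nonempty] by blast
  have "mx \<in> \<rat>"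
  proof (rule extreme_point_rational[OF mx(1)])
    fix d y assume d: "d \<in> D" "y \<in> K" "mx = (y + real d) / B"
    have "(mx + real d) / B \<le> (y + real d) / B" using mx(2)[OF K_prepend_digit[OF mx(1) d(1)]] d(3) by simp
    then have "mx \<le> y" using B_pos by (simp add: divide_le_cancel)
    then show "y = mx" using mx(2)[OF d(2)] by simp
  qed
  moreover have "mn \<in> \<rat>"
  proof (rule extreme_point_rational[OF mn(1)])
    fix d y assume d: "d \<in> D" "y \<in> K" "mn = (y + real d) / B"
    have "(y + real d) / B \<le> (mn + real d) / B" using mn(2)[OF K_prepend_digit[OF mn(1) d(1)]] d(3) by simp
    then have "y \<le> mn" using B_pos by (simp add: divide_le_cancel)
    then show "y = mn" using mn(2)[OF d(2)] by simp
  qed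
  moreover define \<Gamma> where "\<Gamma> = (\<lambda>(d, e). (real e - real d - (mx - mn)) / B) ` (D \<times> D)"
  ultimately have "\<Gamma> \<subseteq> \<rat>" by (auto simp: \<Gamma>_def)
  have "finite \<Gamma>" using finite_D by (simp add: \<Gamma>_def)
  \<comment> \<open>The exponent \<open>n\<close> bounds the number of magnifications;
    \<open>n = 0\<close> is impossible because gaps lie in [0, 1].\<close>
  have main: "\<exists>j::nat. B ^ j * (v - u) \<in> \<Gamma>" if "gap u v" "1 < B ^ n * (v - u)" for n u v
    using that
  proof (induction n arbitrary: u v)
    case 0
    then show ?case using K_bounds[of u] K_bounds[of v] by (simp add: gap_def)
  next
    case (Suc n)
    have uv: "u \<in> K" "v \<in> K" "u < v" "\<And>w. w \<in> K \<Longrightarrow> u < w \<Longrightarrow> w < v \<Longrightarrow> False"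
      using Suc.prems(1) by (auto simp: gap_def)
    show ?case
    proof (cases "\<exists>d\<in>D. B * u - real d \<in> K \<and> B * v - real d \<in> K")
      case True
      then obtain d where d: "d \<in> D" "B * u - real d \<in> K" "B * v - real d \<in> K" by blast
      have "False" if w: "w \<in> K" "B * u - real d < w" "w < B * v - real d" for w
      proof (rule uv(4)[OF K_prepend_digit[OF w(1) d(1)]])
        show "u < (w + real d) / B" "(w + real d) / B < v"
          using w(2,3) B_pos by (simp_all add: pos_less_divide_eq pos_divide_less_eq mult.commute)
      qed
      then have "gap (B * u - real d) (B * v - real d)"
        unfolding gap_def using d uv(3) B_pos by auto
      moreover have eq: "B ^ j * ((B * v - real d) - (B * u - real d)) = B ^ Suc j * (v - u)" for j
        by (simp add: algebra_simps)
      ultimately obtain j where "B ^ Suc j * (v - u) \<in> \<Gamma>"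
        using Suc.IH[of "B * u - real d" "B * v - real d"] Suc.prems(2) unfolding eq by blast
      then show ?thesis by blast
    next
      \<comment> \<open>the endpoints of the gap are then the maximum and the minimum of two first-level pieces\<close>
      case False
      obtain d where d: "d \<in> D" "B * u - real d \<in> K" using K_first_digit[OF uv(1)] by blast
      obtain e where e: "e \<in> D" "B * v - real e \<in> K" using K_first_digit[OF uv(2)] by blast
      have bd: "real d \<le> B * u" "B * u \<le> real d + 1" "real e \<le> B * v" "B * v \<le> real e + 1"
        using K_bounds[OF d(2)] K_bounds[OF e(2)] by auto
      have "B * u < B * v" using uv(3) B_pos by simp
      then have "d < e + 1" using bd by linarith
      moreover have "d \<noteq> e" using False d e by blast
      ultimately have de: "real d + 1 \<le> real e" by linarith
      have mxK: "(mx + real d) / B \<in> K" and mnK: "(mn + real e) / B \<in> K"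
        using K_prepend_digit mx(1) mn(1) d(1) e(1) by blast+
      have "B * u = mx + real d"
      proof (rule ccontr)
        assume "B * u \<noteq> mx + real d"
        then have "B * u < mx + real d" using mx(2)[OF d(2)] by linarith
        then have "u < (mx + real d) / B" using B_pos by (simp add: pos_less_divide_eq mult.commute)
        then have "v \<le> (mx + real d) / B" using uv(4)[OF mxK] by force
        then have "B * v \<le> mx + real d" using B_pos by (simp add: pos_le_divide_eq mult.commute)
        \<comment> \<open>Squeezed from \<open>B * v \<ge> e \<ge> d + 1 \<ge> mx + d\<close>; then
          \<open>v\<close> would share the piece \<open>d\<close> with \<open>u\<close>.\<close>
        then have "B * v - real d = mx" using K_bounds[OF mx(1)] de bd by linarith
        then show False using False d mx(1) by auto
      qed
      moreover have "B * v = mn + real e"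
      proof (rule ccontr)
        assume "B * v \<noteq> mn + real e"
        then have "mn + real e < B * v" using mn(2)[OF e(2)] by linarith
        then have "(mn + real e) / B < v" using B_pos by (simp add: pos_divide_less_eq mult.commute)
        then have "(mn + real e) / B \<le> u" using uv(4)[OF mnK] by force
        then have "mn + real e \<le> B * u" using B_pos by (simp add: pos_divide_le_eq mult.commute)
        then have "B * u - real e = mn" using K_bounds[OF mn(1)] de bd by linarith
        then show False using False e mn(1) by auto
      qed
      ultimately have "B * (v - u) = real e - real d - (mx - mn)" by (simp add: right_diff_distrib)
      then have "v - u = (real e - real d - (mx - mn)) / B" using B_pos by (simp add: field_simps)
      then have "B ^ 0 * (v - u) \<in> \<Gamma>" using d(1) e(1) by (auto simp: \<Gamma>_def)
      then show ?thesis by blast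
    qed
  qed
  have "\<exists>j::nat. B ^ j * (v - u) \<in> \<Gamma>" if "gap u v" for u v
  proof -
    have "u < v" using that by (simp add: gap_def)
    obtain n where "1 / (v - u) < B ^ n" using B_power_unbounded by blast
    then have "1 < B ^ n * (v - u)" using \<open>u < v\<close> by (simp add: pos_divide_less_eq)
    then show ?thesis using main[OF that] by blast
  qed
  then show ?thesis using \<open>finite \<Gamma>\<close> \<open>\<Gamma> \<subseteq> \<rat>\<close> by blast
qed

text \<open>Rescaling one gap \<open>k\<close> times yields lengths
  \<open>\<bar>\<mu>\<bar> ^ k * h\<close> up to powers of \<open>b\<close>, all falling into a
  finite set of rationals. A coincidence for two exponents gives the power relation.\<close>

lemma local_embedding_ratio_power:
  assumes "card D < b" "\<mu> \<noteq> 0" "K \<inter> {0<..<1} = copy \<mu> t \<inter> {0<..<1}"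
  shows "\<bar>\<mu>\<bar> \<in> \<rat> \<and> (\<exists>n>0. \<exists>z::int. \<bar>\<mu>\<bar> ^ n = B powi z)"
proof -
  obtain \<Gamma> where \<Gamma>: "finite \<Gamma>" "\<Gamma> \<subseteq> \<rat>" "\<And>u v. gap u v \<Longrightarrow> \<exists>j::nat. B ^ j * (v - u) \<in> \<Gamma>"
    using gap_lengths_finite by blast
  obtain u0 v0 where g0: "gap u0 v0" using gap_exists[OF assms(1)] by blast
  define h where "h = v0 - u0"
  have h: "0 < h" using g0 by (simp add: h_def gap_def)
  have iter: "\<exists>u v n. gap u v \<and> v - u = \<bar>\<mu>\<bar> ^ k * h / B ^ n" for k
  proof (induction k)
    case 0
    show ?case using g0 by (intro exI[of _ u0] exI[of _ v0] exI[of _ 0]) (simp add: h_def)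
  next
    case (Suc k)
    then obtain u v n where *: "gap u v" "v - u = \<bar>\<mu>\<bar> ^ k * h / B ^ n" by blast
    obtain m u' v' where "gap u' v'" "v' - u' = \<bar>\<mu>\<bar> * (v - u) / B ^ m"
      using gap_scale_by_embedding[OF assms(2,3) *(1)] by blast
    moreover from this(2) have "v' - u' = \<bar>\<mu>\<bar> ^ Suc k * h / B ^ (n + m)"
      unfolding *(2) by (simp add: power_add)
    ultimately show ?case by blast
  qed
  have "\<exists>z::int. \<bar>\<mu>\<bar> ^ k * h * B powi z \<in> \<Gamma>" for k
  proof -
    obtain u v n where *: "gap u v" "v - u = \<bar>\<mu>\<bar> ^ k * h / B ^ n" using iter by blast
    obtain j where "B ^ j * (\<bar>\<mu>\<bar> ^ k * h / B ^ n) \<in> \<Gamma>" using \<Gamma>(3)[OF *(1)] unfolding *(2) by blast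
    also have "B ^ j * (\<bar>\<mu>\<bar> ^ k * h / B ^ n) = \<bar>\<mu>\<bar> ^ k * h * B powi (int j - int n)"
      using B_pos by (simp add: power_int_diff)
    finally show ?thesis by blast
  qed
  then obtain z :: "nat \<Rightarrow> int" where z: "\<And>k. \<bar>\<mu>\<bar> ^ k * h * B powi z k \<in> \<Gamma>" by metis
  define \<phi> where "\<phi> k = \<bar>\<mu>\<bar> ^ k * h * B powi z k" for k
  \<comment> \<open>Pigeonhole: infinitely many exponents, finitely many values.\<close>
  have "finite (range \<phi>)" using \<Gamma>(1) z by (auto simp: \<phi>_def intro: finite_subset)
  then have "\<not> inj \<phi>" using finite_imageD infinite_UNIV_nat by blast
  then obtain i j where ij: "\<phi> i = \<phi> j" "i < j"
    unfolding inj_def by (metis linorder_neqE_nat)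
  have pw: "B powi m \<noteq> 0" for m using B_pos by simp
  have "\<bar>\<mu>\<bar> ^ j = \<bar>\<mu>\<bar> ^ i * \<bar>\<mu>\<bar> ^ (j - i)" using ij(2) by (simp flip: power_add)
  then have "B powi z i = \<bar>\<mu>\<bar> ^ (j - i) * B powi z j"
    using ij(1) h assms(2) by (simp add: \<phi>_def)
  then have "\<bar>\<mu>\<bar> ^ (j - i) = B powi (z i - z j)"
    using pw B_pos by (simp add: power_int_diff eq_divide_eq)
  then have "\<exists>n>0. \<exists>z::int. \<bar>\<mu>\<bar> ^ n = B powi z" using ij(2) by (intro exI[of _ "j - i"]) auto
  moreover have "\<bar>\<mu>\<bar> \<in> \<rat>"
  proof -
    \<comment> \<open>Comparing the exponents 1 and 0 cancels \<open>h\<close>, leaving a quotient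
      of rationals.\<close>
    have "\<bar>\<mu>\<bar> = \<phi> 1 / \<phi> 0 * (B powi z 0 / B powi z 1)"
      using pw h by (simp add: \<phi>_def)
    also have "\<dots> \<in> \<rat>"
      using \<Gamma>(2) z[of 0] z[of 1] by (intro Rats_mult Rats_divide) (auto simp: \<phi>_def power_int_def)
    finally show ?thesis .
  qed
  ultimately show ?thesis by blast
qed

end

section \<open>Rational roots of prime powers\<close>

lemma rational_root_of_prime_power:
  assumes "prime b" "x \<in> \<rat>" "0 < x" "0 < n" "x ^ n = real b ^ m"
  shows "\<exists>k. x = real b ^ k"
proof -
  obtain p q :: nat where pq: "q \<noteq> 0" "\<bar>x\<bar> = real p / real q" "coprime p q"
    using Rats_abs_nat_div_natE[OF assms(2)] by metis
  then have x: "x = real p / real q" using assms(3) by simp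
  have "real p ^ n = real b ^ m * real q ^ n"
    using assms(5) pq(1) by (simp add: x power_divide divide_eq_eq)
  then have eq: "p ^ n = b ^ m * q ^ n" by (metis of_nat_eq_iff of_nat_mult of_nat_power)
  \<comment> \<open>In lowest terms this forces the denominator \<open>q\<close> to be 1, and the
    numerator then divides a power of a prime.\<close>
  have "q dvd p ^ n" unfolding eq using assms(4) by (simp add: dvd_power)
  moreover have "coprime q (p ^ n)" using pq(3) by (simp add: coprime_commute)
  ultimately have "is_unit q" using coprime_common_divisor[of q "p ^ n" q] by simp
  then have "q = 1" by simp
  then have "p ^ n = b ^ m" using eq by simp
  then have "p dvd b ^ m" using assms(4) by (metis dvd_power)
  then obtain k where "p = b ^ k" using divides_primepow_nat[OF assms(1)] by blast
  then show ?thesis using x \<open>q = 1\<close> by auto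
qed

lemma rational_root_of_prime_powi:
  assumes "prime b" "x \<in> \<rat>" "0 < x" "0 < n" "x ^ n = real b powi z"
  shows "\<exists>k::int. x = real b powi k"
proof (cases "0 \<le> z")
  case True
  then have "x ^ n = real b ^ nat z" using assms(5) by (simp add: power_int_def)
  then obtain k where "x = real b ^ k" using rational_root_of_prime_power[OF assms(1-4)] by blast
  then show ?thesis by (intro exI[of _ "int k"]) simp
next
  case False
  then have "(inverse x) ^ n = real b ^ nat (- z)"
    using assms(5) by (simp add: power_int_def power_inverse)
  then obtain k where "inverse x = real b ^ k"
    using rational_root_of_prime_power[OF assms(1) _ _ assms(4), of "inverse x"] assms(2,3) by auto
  then have "x = inverse (real b ^ k)" by (metis inverse_inverse_eq)
  then show ?thesis by (intro exI[of _ "- int k"]) (simp add: power_int_minus)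
qed

section \<open>Ratios of full copies and the equivalence\<close>

context missing_digits
begin

text \<open>\<open>full_copy_covers_K\<close> is applied twice. The first use gives a copy
  containing \<open>K\<close>; its inverse maps \<open>K\<close> into \<open>K\<close>, so the
  second use also yields the reverse inclusion inside (0, 1), which the gap argument needs.\<close>

lemma full_copy_ratio:
  assumes "prime b" "card D < b" "\<gamma> \<noteq> 0" "\<And>m. full (copy \<gamma> \<alpha> \<inter> K) m"
  shows "\<exists>k::int. \<bar>\<gamma>\<bar> = B powi k"
proof -
  obtain l t where lt: "K \<subseteq> copy (\<gamma> * B ^ l) t"
    using full_copy_covers_K[OF assms(3) _ assms(4)] by blast
  define \<delta> where "\<delta> = \<gamma> * B ^ l"
  have \<delta>: "\<delta> \<noteq> 0" using assms(3) B_pos by (simp add: \<delta>_def)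
  have lt: "K \<subseteq> copy \<delta> t" using lt by (simp add: \<delta>_def)
  define \<mu> where "\<mu> = 1 / \<delta>"
  have "copy \<mu> (- t / \<delta>) \<subseteq> K"
  proof
    fix x assume "x \<in> copy \<mu> (- t / \<delta>)"
    then obtain k where k: "k \<in> K" "x = \<mu> * k + - t / \<delta>" by (auto simp: copy_def)
    then obtain k' where k': "k' \<in> K" "k = \<delta> * k' + t" using lt by (auto simp: copy_def)
    have "x = k'" using \<delta> by (simp add: k(2) k'(2) \<mu>_def add_divide_distrib)
    then show "x \<in> K" using k'(1) by simp
  qed
  moreover have "\<mu> \<noteq> 0" using \<delta> by (simp add: \<mu>_def)
  ultimately obtain l' t' where l': "K \<subseteq> copy (\<mu> * B ^ l') t'" "copy (\<mu> * B ^ l') t' \<inter> {0<..<1} \<subseteq> K"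
    using full_copy_covers_K[OF _ subset_refl self_copy_full] by blast
  define \<nu> where "\<nu> = \<mu> * B ^ l'"
  have \<nu>: "\<nu> \<noteq> 0" using \<open>\<mu> \<noteq> 0\<close> B_pos by (simp add: \<nu>_def)
  have "K \<inter> {0<..<1} = copy \<nu> t' \<inter> {0<..<1}" using l' unfolding \<nu>_def by blast
  from local_embedding_ratio_power[OF assms(2) \<nu> this]
  obtain n z where "\<bar>\<nu>\<bar> \<in> \<rat>" "0 < n" "\<bar>\<nu>\<bar> ^ n = B powi z" by blast
  then obtain k where k: "\<bar>\<nu>\<bar> = B powi k"
    using rational_root_of_prime_powi[OF assms(1)] \<nu> by (metis zero_less_abs_iff)
  \<comment> \<open>Inverting and zooming changed the ratio only by powers of
    \<open>b\<close>.\<close>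
  have "\<nu> * \<gamma> = B ^ l' / B ^ l"
    using assms(3) B_pos by (simp add: \<nu>_def \<mu>_def \<delta>_def)
  then have "\<bar>\<nu>\<bar> * \<bar>\<gamma>\<bar> = B ^ l' / B ^ l" using B_pos by (simp flip: abs_mult)
  then have "\<bar>\<gamma>\<bar> = B ^ l' / B ^ l / B powi k"
    unfolding k[symmetric] using \<nu> by (metis abs_zero nonzero_mult_div_cancel_left abs_eq_0)
  also have "\<dots> = B powi (int l' - int l - k)" using B_pos by (simp add: power_int_diff)
  finally show ?thesis by blast
qed

text \<open>For \<open>k \<ge> 0\<close> the copy magnifies a cylinder of \<open>K\<close> back to
  \<open>K\<close>, hence contains \<open>K\<close>; for \<open>k < 0\<close> it can be placed as a
  cylinder inside \<open>K\<close>.\<close>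

lemma power_copy_meets_K:
  "\<exists>\<alpha> c e. c \<noteq> 0 \<and> (\<lambda>x. c * x + e) ` K \<subseteq> copy (B powi k) \<alpha> \<inter> K"
proof -
  have "prefixes n \<noteq> {}" for n using card_prefixes[of n] card_D by fastforce
  then obtain p where p: "p \<in> prefixes (nat \<bar>k\<bar>)" by blast
  define n where "n = nat \<bar>k\<bar>"
  have cylK: "(x + of_int p) / B ^ n \<in> K" if "x \<in> K" for x
    using cylI[OF that] cyl_subset_K[OF p] unfolding n_def by blast
  show ?thesis
  proof (cases "0 \<le> k")
    case True
    then have Bk: "B powi k = B ^ n" by (simp add: n_def power_int_def)
    have "x \<in> copy (B powi k) (- of_int p)" if "x \<in> K" for x
      using copyI[OF cylK[OF that], of "B ^ n" "- of_int p"] B_pos by (simp add: Bk)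
    then show ?thesis by (intro exI[of _ "- of_int p"] exI[of _ 1] exI[of _ 0]) auto
  next
    case False
    then have Bk: "B powi k = 1 / B ^ n" by (simp add: n_def power_int_def divide_inverse power_inverse)
    have "1 / B ^ n * x + of_int p / B ^ n \<in> K" if "x \<in> K" for x
      using cylK[OF that] by (simp add: add_divide_distrib)
    then show ?thesis unfolding Bk
      using B_pos by (intro exI[of _ "of_int p / B ^ n"] exI[of _ "1 / B ^ n"]) (auto simp: copy_def)
  qed
qed

end

theorem corollary1p6:
  fixes b :: nat and D :: "nat set" and \<gamma> :: real
  assumes "b \<ge> 3"
    and "D \<subseteq> {0..b - 1}" and "2 \<le> card D" and "card D < b"
    and "prime b"
    and "\<exists>c::real. missing_digit_set b D = (\<lambda>x. c - x) ` missing_digit_set b D"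
  shows "(\<forall>\<alpha>::real.
            upper_minkowski_dim
              ((\<lambda>x. \<gamma> * x + \<alpha>) ` missing_digit_set b D \<inter> missing_digit_set b D)
            < hausdorff_dim (missing_digit_set b D))
         \<longleftrightarrow> \<gamma> \<notin> {real b powi k | k :: int. True} \<union> {- (real b powi k) | k :: int. True}"
proof -
  interpret missing_digits b D
  proof
    show "D \<subseteq> {..<b}" using assms(1,2) by (force simp: subset_eq)
  qed (rule assms(3))
  have "(\<forall>\<alpha>. upper_minkowski_dim (copy \<gamma> \<alpha> \<inter> K) < ereal sdim)
      \<longleftrightarrow> \<gamma> \<notin> {B powi k | k :: int. True} \<union> {- (B powi k) | k :: int. True}"
  proof (intro iffI allI notI)
    fix \<alpha>
    assume \<gamma>: "\<gamma> \<notin> {B powi k | k :: int. True} \<union> {- (B powi k) | k :: int. True}"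
    have "\<exists>m. \<not> full (copy \<gamma> \<alpha> \<inter> K) m"
    proof (rule ccontr)
      assume "\<nexists>m. \<not> full (copy \<gamma> \<alpha> \<inter> K) m"
      then have full: "\<And>m. full (copy \<gamma> \<alpha> \<inter> K) m" by blast
      show False
      proof (cases "\<gamma> = 0")
        \<comment> \<open>The copy degenerates to the point \<open>\<alpha>\<close>.\<close>
        case True
        then have "copy \<gamma> \<alpha> \<inter> K \<subseteq> {\<alpha>}" by (auto simp: copy_def)
        then have "full {\<alpha>} 2" using full[of 2] unfolding full_def by blast
        then show False using singleton_not_full by blast
      next
        case False
        then obtain k where "\<bar>\<gamma>\<bar> = B powi k"
          using full_copy_ratio[OF assms(5,4) _ full] by blast
        then have "\<gamma> = B powi k \<or> \<gamma> = - (B powi k)" by linarith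
        then show False using \<gamma> by blast
      qed
    qed
    then show "upper_minkowski_dim (copy \<gamma> \<alpha> \<inter> K) < ereal sdim"
      using upper_minkowski_dim_less_if_not_full[of "copy \<gamma> \<alpha> \<inter> K"] by blast
  next
    assume small: "\<forall>\<alpha>. upper_minkowski_dim (copy \<gamma> \<alpha> \<inter> K) < ereal sdim"
      and "\<gamma> \<in> {B powi k | k :: int. True} \<union> {- (B powi k) | k :: int. True}"
    then obtain k where k: "\<gamma> = B powi k \<or> \<gamma> = - (B powi k)" by blast
    obtain \<alpha> c e where c: "c \<noteq> 0" "(\<lambda>x. c * x + e) ` K \<subseteq> copy (B powi k) \<alpha> \<inter> K"
      using power_copy_meets_K by blast
    have "\<exists>\<alpha>'. copy (B powi k) \<alpha> \<subseteq> copy \<gamma> \<alpha>'"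
    proof (cases "\<gamma> = B powi k")
      case False
      then have neg: "\<gamma> = - (B powi k)" using k by blast
      \<comment> \<open>Symmetry turns the ratio \<open>B powi k\<close> into its negative:
        reflecting \<open>K\<close> only shifts the offset by \<open>B powi k * s\<close>.\<close>
      obtain s where s: "K = (\<lambda>x. s - x) ` K" using assms(6) by blast
      have "B powi k * x + \<alpha> \<in> copy \<gamma> (\<alpha> + B powi k * s)" if "x \<in> K" for x
      proof -
        have "x \<in> (\<lambda>x. s - x) ` K" unfolding s[symmetric] by (rule that)
        then obtain x' where x': "x' \<in> K" "x = s - x'" by blast
        have eq: "B powi k * x + \<alpha> = \<gamma> * x' + (\<alpha> + B powi k * s)"
          by (simp add: x'(2) neg algebra_simps)
        show ?thesis unfolding eq by (rule copyI[OF x'(1)])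
      qed
      then show ?thesis by (intro exI[of _ "\<alpha> + B powi k * s"]) (auto simp: copy_def)
    qed blast
    then obtain \<alpha>' where "copy (B powi k) \<alpha> \<subseteq> copy \<gamma> \<alpha>'" by blast
    then have "(\<lambda>x. c * x + e) ` K \<subseteq> copy \<gamma> \<alpha>' \<inter> K" using c(2) by blast
    then have "ereal sdim \<le> upper_minkowski_dim (copy \<gamma> \<alpha>' \<inter> K)"
      using upper_minkowski_dim_ge_if_affine_copy[OF Int_lower2 c(1)] by blast
    then show False using small not_less by blast
  qed
  then show ?thesis by (simp only: hausdorff_dim_K copy_def)
qed

end
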